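(* Let $k\ge 1$ and let $T$ and $T'$ be two $k$-cut search trees on the same $n$-node tree $S$. Then $T$ can be transformed into $T'$ through a sequence of at most $(2k-1)n-(k+1)k+1$ rotations. Moreover, starting with a pointer at the root, $T$ can be transformed into $T'$ through a sequence of $O(k^2n)$ pointer moves and rotations at the pointer. All intermediate trees are $k$-cut trees.
   Context: A search tree on an unrooted tree $S$ (STT) is a rooted tree $T$ with $V(T)=V(S)$ defined recursively: the root $r$ is any node of $S$, and the subtrees of $T$ rooted at the children of $r$ are search trees on the connected components of $S\setminus r$. For $x\in V(T)$, $T_x$ denotes the subtree of $T$ rooted at $x$. A rotation at a node $x$ with parent $p$ (rotation of the edge $\{x,p\}$) produces the tree obtained as follows: $x$ and $p$ swap places; if $x$ has a child $y$ whose subtree $T_y$ contains a node adjacent to $p$ in $S$, then $y$ becomes a child of $p$; all other children of $x$ and $p$ keep their parent. The result is again an STT on $S$. For $A\subseteq V(S)$, the boundary $\delta_S(A)$ is the set of nodes $u\in V(S)\setminus A$ adjacent in $S$ to some node of $A$. An STT $T$ on $S$ is a $k$-cut tree if $|\delta_S(V(T_x))|\le k$ for every $x\in V(S)$. In the pointer model, a pointer sits at a node; one step either moves the pointer from its current node to the parent or to a child, or rotates the edge between the node at the pointer and its parent.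
   Formalization: For k > n the rotation bound is taken as its value at k = n, namely (n-1)^2, because the printed formula fails there (for n = 1, k = 2 it is -2); for k ≤ n the bound is as printed. *)

theory Defs
  imports Main
begin

text \<open>
  An unrooted tree is given by its node set \<open>V\<close> and its adjacency relation \<open>E\<close>.
\<close>

definition is_cycle :: "('a \<Rightarrow> 'a \<Rightarrow> bool) \<Rightarrow> 'a list \<Rightarrow> bool" where
  "is_cycle E c \<longleftrightarrow>
     3 \<le> length c \<and> distinct c \<and> successively E c \<and> E (last c) (hd c)"

definition reachable_in :: "('a \<Rightarrow> 'a \<Rightarrow> bool) \<Rightarrow> 'a set \<Rightarrow> 'a \<Rightarrow> 'a \<Rightarrow> bool" where
  "reachable_in E A = (\<lambda>u v. u \<in> A \<and> v \<in> A \<and> E u v)\<^sup>*\<^sup>*"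

definition is_tree :: "'a set \<Rightarrow> ('a \<Rightarrow> 'a \<Rightarrow> bool) \<Rightarrow> bool" where
  "is_tree V E \<longleftrightarrow>
     finite V \<and> V \<noteq> {} \<and>
     (\<forall>u v. E u v \<longrightarrow> u \<in> V \<and> v \<in> V) \<and> symp E \<and> irreflp E \<and>
     (\<forall>u\<in>V. \<forall>v\<in>V. reachable_in E V u v) \<and> (\<nexists>c. is_cycle E c)"

definition components :: "('a \<Rightarrow> 'a \<Rightarrow> bool) \<Rightarrow> 'a set \<Rightarrow> 'a set set" where
  "components E A = {{v \<in> A. reachable_in E A u v} | u. u \<in> A}"

definition boundary :: "'a set \<Rightarrow> ('a \<Rightarrow> 'a \<Rightarrow> bool) \<Rightarrow> 'a set \<Rightarrow> 'a set" where
  "boundary V E A = {u \<in> V - A. \<exists>a\<in>A. E u a}"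

text \<open>
  A rooted tree is represented by its parent map. The root and everything that is not
  a node of the tree are mapped to \<^const>\<open>None\<close>, so that equal trees have equal maps.
\<close>

type_synonym 'a rooted_tree = "'a \<rightharpoonup> 'a"

definition children :: "'a rooted_tree \<Rightarrow> 'a \<Rightarrow> 'a set" where
  "children T x = {y. T y = Some x}"

definition subtree_nodes :: "'a rooted_tree \<Rightarrow> 'a \<Rightarrow> 'a set" where
  "subtree_nodes T x = {v. (\<lambda>u w. T u = Some w)\<^sup>*\<^sup>* v x}"

text \<open>
  \<open>search_tree_at E T A r\<close>: the part of \<open>T\<close> rooted at \<open>r\<close> is a search tree on the
  subgraph induced by \<open>A\<close>. The bijection says that every component of \<open>A - {r}\<close> is
  the node set of the subtree of exactly one child of \<open>r\<close>, and that there are no other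
  children.
\<close>

inductive search_tree_at ::
    "('a \<Rightarrow> 'a \<Rightarrow> bool) \<Rightarrow> 'a rooted_tree \<Rightarrow> 'a set \<Rightarrow> 'a \<Rightarrow> bool"
  for E T where
  "\<lbrakk> r \<in> A;
     bij_betw (subtree_nodes T) (children T r) (components E (A - {r}));
     \<forall>c\<in>children T r. search_tree_at E T (subtree_nodes T c) c \<rbrakk>
   \<Longrightarrow> search_tree_at E T A r"

definition root_of :: "'a set \<Rightarrow> 'a rooted_tree \<Rightarrow> 'a \<Rightarrow> bool" where
  "root_of V T r \<longleftrightarrow> r \<in> V \<and> T r = None"

definition is_stt :: "'a set \<Rightarrow> ('a \<Rightarrow> 'a \<Rightarrow> bool) \<Rightarrow> 'a rooted_tree \<Rightarrow> bool" where
  "is_stt V E T \<longleftrightarrow> dom T \<subseteq> V \<and> (\<exists>r. root_of V T r \<and> search_tree_at E T V r)"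

definition k_cut :: "nat \<Rightarrow> 'a set \<Rightarrow> ('a \<Rightarrow> 'a \<Rightarrow> bool) \<Rightarrow> 'a rooted_tree \<Rightarrow> bool" where
  "k_cut k V E T \<longleftrightarrow>
     is_stt V E T \<and> (\<forall>x\<in>V. card (boundary V E (subtree_nodes T x)) \<le> k)"

text \<open>
  In a search tree at most one child \<open>v\<close> of \<open>x\<close> satisfies the condition of the third branch,
  so no choice is needed. If \<open>p\<close> is the root, then \<open>T p = None\<close> makes \<open>x\<close> the new root.
\<close>

definition rotation_at ::
    "('a \<Rightarrow> 'a \<Rightarrow> bool) \<Rightarrow> 'a \<Rightarrow> 'a rooted_tree \<Rightarrow> 'a rooted_tree \<Rightarrow> bool" where
  "rotation_at E x T T' \<longleftrightarrow>
     (\<exists>p. T x = Some p \<and>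
        T' = (\<lambda>v. if v = x then T p
                  else if v = p then Some x
                  else if v \<in> children T x \<and> (\<exists>u\<in>subtree_nodes T v. E p u) then Some p
                  else T v))"

inductive pointer_step ::
    "('a \<Rightarrow> 'a \<Rightarrow> bool) \<Rightarrow> 'a rooted_tree \<times> 'a \<Rightarrow> 'a rooted_tree \<times> 'a \<Rightarrow> bool"
  for E where
  to_parent: "T x = Some p \<Longrightarrow> pointer_step E (T, x) (T, p)"
| to_child: "c \<in> children T x \<Longrightarrow> pointer_step E (T, x) (T, c)"
| rotate: "rotation_at E x T T' \<Longrightarrow> pointer_step E (T, x) (T', x)"

text \<open>
  For \<open>k \<le> n\<close> this is \<open>(2k - 1)n - (k + 1)k + 1\<close>. For fixed \<open>n\<close> that formula decreases once
  \<open>k \<ge> n\<close>, eventually below \<open>0\<close>, and cannot be a bound for all \<open>k\<close>. Boundaries in an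
  \<open>n\<close>-node tree have fewer than \<open>n\<close> elements, so for \<open>k > n\<close> the \<open>k\<close>-cut trees are
  exactly the \<open>n\<close>-cut trees, and the value at \<open>n\<close> is used.
\<close>

definition rotation_bound :: "nat \<Rightarrow> nat \<Rightarrow> int" where
  "rotation_bound k n =
     (let j = int (min k n) in (2 * j - 1) * int n - (j + 1) * j + 1)"

end

theory Submission
  imports Defs
begin

text \<open>
  The total boundary size of a \<open>k\<close>-cut tree lies between \<open>n - 1\<close> and \<open>\<Sum>i<n. min i k\<close>, since a
  boundary consists of proper ancestors. Let \<open>m \<ge> 2\<close> be the largest boundary size in the tree, and
  let \<open>x\<close> have a boundary of size \<open>m\<close> and its parent \<open>p\<close> a smaller one. The rotation at \<open>x\<close> gives
  \<open>x\<close> the node set of \<open>p\<close>, and the new node set of \<open>p\<close> again has fewer than \<open>m\<close> boundary nodes: all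
  of them but \<open>x\<close> are boundary nodes, other than \<open>p\<close> and \<open>x\<close>, of the single subtree that changes its
  parent. So every such rotation decreases the total, and repeating it ends in a 1-cut tree, which
  is just a rooting of \<open>S\<close>. For each \<open>m\<close>, one depth-first traversal performs all these rotations
  with \<open>O(n)\<close> pointer steps. Two rootings are connected by at most \<open>n - 1\<close> rotations that move the
  root along a path, and walks can be reversed.
\<close>

section \<open>Paths and boundaries in trees\<close>

text \<open>The chain is built from its end. If the new first node already occurs on the path,
  everything before that occurrence is dropped.\<close>

lemma rtranclp_distinct_path:
  assumes "r\<^sup>*\<^sup>* a b"
  shows "\<exists>xs. xs \<noteq> [] \<and> hd xs = a \<and> last xs = b \<and> successively r xs \<and> distinct xs"
  using assms
proof (induction rule: converse_rtranclp_induct)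
  case base
  show ?case by (rule exI[of _ "[b]"]) simp
next
  case (step a c)
  then obtain xs where xs: "xs \<noteq> []" "hd xs = c" "last xs = b" "successively r xs" "distinct xs"
    by blast
  show ?case
  proof (cases "a \<in> set xs")
    case True
    then obtain ys zs where "xs = ys @ a # zs" by (meson split_list)
    with xs show ?thesis
      by (intro exI[of _ "a # zs"]) (auto simp: successively_append_iff)
  next
    case False
    with xs step.hyps show ?thesis
      by (intro exI[of _ "a # xs"]) (cases xs; auto)
  qed
qed

lemma reachable_in_mono:
  assumes "reachable_in E A u v" "A \<subseteq> B"
  shows "reachable_in E B u v"
proof -
  have "(\<lambda>u v. u \<in> A \<and> v \<in> A \<and> E u v) \<le> (\<lambda>u v. u \<in> B \<and> v \<in> B \<and> E u v)"
    using assms(2) by auto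
  from rtranclp_mono[OF this] assms(1) show ?thesis
    unfolding reachable_in_def by blast
qed

lemma reachable_in_edge:
  assumes "u \<in> A" "v \<in> A" "E u v"
  shows "reachable_in E A u v"
  unfolding reachable_in_def using assms by blast

lemma reachable_in_refl [simp]: "reachable_in E A u u"
  unfolding reachable_in_def by simp

lemma reachable_in_trans:
  "reachable_in E A u v \<Longrightarrow> reachable_in E A v w \<Longrightarrow> reachable_in E A u w"
  unfolding reachable_in_def by (rule rtranclp_trans)

lemma reachable_in_closed:
  assumes "reachable_in E A u v" "u \<in> B" "\<And>a b. a \<in> B \<Longrightarrow> b \<in> A \<Longrightarrow> E a b \<Longrightarrow> b \<in> B"
  shows "v \<in> B"
  using assms(1,2) unfolding reachable_in_def
  by (induction rule: rtranclp_induct) (use assms(3) in auto)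

locale unrooted_tree =
  fixes V :: "'a set" and E :: "'a \<Rightarrow> 'a \<Rightarrow> bool"
  assumes tree: "is_tree V E"
begin

lemma finite_V: "finite V"
  and edge_in_V: "E u v \<Longrightarrow> u \<in> V" "E u v \<Longrightarrow> v \<in> V"
  and edge_sym: "E u v \<Longrightarrow> E v u"
  and edge_irrefl: "\<not> E u u"
  and connected_V: "u \<in> V \<Longrightarrow> v \<in> V \<Longrightarrow> reachable_in E V u v"
  and acyclic: "\<not> is_cycle E c"
  using tree unfolding is_tree_def by (auto dest: sympD irreflpD)

lemma reachable_in_sym:
  assumes "reachable_in E A u v"
  shows "reachable_in E A v u"
proof -
  have "symp (\<lambda>u v. u \<in> A \<and> v \<in> A \<and> E u v)"
    by (intro sympI) (auto intro: edge_sym)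
  then show ?thesis
    using assms unfolding reachable_in_def by (meson sympD symp_rtranclp)
qed

text \<open>Two different neighbours of \<open>z\<close> in \<open>A\<close> would be joined by a
  distinct path inside \<open>A\<close>, and \<open>z\<close> would close this path to a
  cycle.\<close>

lemma unique_neighbour:
  assumes "reachable_in E A a b" "z \<notin> A" "a \<in> A" "E z a" "E z b"
  shows "a = b"
proof (rule ccontr)
  assume "a \<noteq> b"
  obtain xs where xs: "xs \<noteq> []" "hd xs = a" "last xs = b" "distinct xs"
    and succ: "successively (\<lambda>u v. u \<in> A \<and> v \<in> A \<and> E u v) xs"
    using rtranclp_distinct_path[OF assms(1)[unfolded reachable_in_def]] by blast
  have "set xs \<subseteq> A"
    using xs(1,2) succ assms(3)
  proof (induction xs arbitrary: a)
    case (Cons y ys)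
    then show ?case by (cases ys) auto
  qed simp
  moreover have "successively E xs"
    using succ by (rule successively_mono) auto
  moreover have "2 \<le> length xs"
    using xs \<open>a \<noteq> b\<close> by (cases xs rule: remdups_adj.cases) auto
  ultimately have "is_cycle E (z # xs)"
    using xs assms(2,4,5) edge_sym[OF assms(5)]
    unfolding is_cycle_def by (cases xs) auto
  then show False using acyclic by blast
qed

end

section \<open>Rooted trees\<close>

lemma self_in_subtree [simp]: "x \<in> subtree_nodes T x"
  unfolding subtree_nodes_def by simp

lemma subtree_trans:
  "u \<in> subtree_nodes T v \<Longrightarrow> v \<in> subtree_nodes T w \<Longrightarrow> u \<in> subtree_nodes T w"
  unfolding subtree_nodes_def by auto

lemma child_in_subtree: "T c = Some p \<Longrightarrow> c \<in> subtree_nodes T p"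
  unfolding subtree_nodes_def by auto

lemma subtree_cases:
  assumes "u \<in> subtree_nodes T v"
  obtains "u = v" | p where "T u = Some p" "p \<in> subtree_nodes T v"
  using assms unfolding subtree_nodes_def mem_Collect_eq
  by (cases rule: converse_rtranclpE) auto

lemma parent_in_subtree:
  assumes "u \<in> subtree_nodes T v" "u \<noteq> v" "T u = Some p"
  shows "p \<in> subtree_nodes T v"
  using assms(1) by (cases rule: subtree_cases) (use assms in auto)

lemma subtree_None: "u \<in> subtree_nodes T v \<Longrightarrow> T u = None \<Longrightarrow> u = v"
  by (erule subtree_cases) auto

lemma subtree_unfold:
  "subtree_nodes T x = insert x (\<Union>c\<in>children T x. subtree_nodes T c)"
proof -
  have "u = x \<or> (\<exists>c. T c = Some x \<and> u \<in> subtree_nodes T c)" if "u \<in> subtree_nodes T x" for u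
    using that unfolding subtree_nodes_def mem_Collect_eq
    by (cases rule: rtranclp.cases) auto
  then show ?thesis
    using subtree_trans child_in_subtree by (fastforce simp: children_def)
qed

text \<open>The ancestors of \<open>u\<close> form a chain: on the way up from \<open>u\<close>,
  whichever of \<open>v\<close> and \<open>w\<close> is met first lies below the other.\<close>

lemma subtree_linear:
  assumes "u \<in> subtree_nodes T v" "u \<in> subtree_nodes T w"
  shows "v \<in> subtree_nodes T w \<or> w \<in> subtree_nodes T v"
proof -
  have "(\<lambda>u w. T u = Some w)\<^sup>*\<^sup>* u v" using assms(1) by (simp add: subtree_nodes_def)
  then show ?thesis using assms(2)
  proof (induction rule: converse_rtranclp_induct)
    case base
    then show ?case by blast
  next
    case (step y z)
    show ?case
    proof (cases "y = w")
      case True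
      have "y \<in> subtree_nodes T v"
        using step.hyps unfolding subtree_nodes_def by (auto intro: converse_rtranclp_into_rtranclp)
      with True show ?thesis by blast
    next
      case False
      with step.prems step.hyps(1) have "z \<in> subtree_nodes T w"
        using parent_in_subtree by metis
      with step.IH show ?thesis .
    qed
  qed
qed

text \<open>Allows the subtrees of a modified tree to be guessed and then checked locally. By
  \<open>less\<close> and \<open>fin\<close> the sets \<open>N\<close> shrink strictly towards the
  children, so induction on their size shows that the recursive equation determines them.\<close>

lemma subtree_nodes_eqI:
  assumes unfold: "\<And>v. N v = insert v (\<Union>c\<in>children T v. N c)"
    and less: "\<And>c v. T c = Some v \<Longrightarrow> v \<notin> N c"
    and fin: "\<And>v. finite (N v)"
  shows "subtree_nodes T = N"
proof (rule ext, rule equalityI; rule subsetI)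
  fix u v
  assume "u \<in> subtree_nodes T v"
  then have "(\<lambda>u w. T u = Some w)\<^sup>*\<^sup>* u v" by (simp add: subtree_nodes_def)
  then show "u \<in> N v"
  proof (induction rule: rtranclp_induct)
    case base
    show ?case using unfold[of u] by blast
  next
    case (step y z)
    then show ?case using unfold[of z] by (auto simp: children_def)
  qed
next
  fix u v
  assume "u \<in> N v"
  then show "u \<in> subtree_nodes T v"
  proof (induction "card (N v)" arbitrary: v rule: less_induct)
    case less
    show ?case
    proof (cases "u = v")
      case False
      then obtain c where c: "T c = Some v" "u \<in> N c"
        using less.prems unfold[of v] by (auto simp: children_def)
      have "N c \<subseteq> N v" "v \<in> N v" using unfold[of v] c(1) by (auto simp: children_def)
      with assms(2)[OF c(1)] have "card (N c) < card (N v)"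
        by (intro psubset_card_mono fin) auto
      from less.hyps[OF this c(2)] c(1) show ?thesis
        by (meson child_in_subtree subtree_trans)
    qed simp
  qed
qed

section \<open>Search trees as families of connected sets\<close>

text \<open>
  The recursive definition of search trees is replaced by two local conditions: all subtrees
  are connected, and adjacent nodes are comparable in the tree order.
\<close>

locale search_tree = unrooted_tree V E for V :: "'a set" and E +
  fixes T :: "'a rooted_tree" and r :: 'a
  assumes dom_T: "dom T \<subseteq> V"
    and root_in_V: "r \<in> V"
    and root_None: "T r = None"
    and subtree_root: "subtree_nodes T r = V"
    and subtree_connected: "x \<in> V \<Longrightarrow> u \<in> subtree_nodes T x \<Longrightarrow> reachable_in E (subtree_nodes T x) u x"
    and edge_comparable: "E u v \<Longrightarrow> u \<in> subtree_nodes T v \<or> v \<in> subtree_nodes T u"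
begin

lemma child_in_V: "T c = Some p \<Longrightarrow> c \<in> V"
  using dom_T by auto

lemma subtree_subset: "x \<in> V \<Longrightarrow> subtree_nodes T x \<subseteq> V"
  using subtree_root subtree_trans by fast

lemma parent_in_V:
  assumes "T c = Some p"
  shows "p \<in> V"
proof -
  have "c \<in> subtree_nodes T r" using child_in_V[OF assms] subtree_root by blast
  then show ?thesis
    using assms root_None subtree_root parent_in_subtree[of c T r p] by (cases "c = r") auto
qed

lemma subtree_finite: "finite (subtree_nodes T x)"
proof (cases "x \<in> V")
  case True
  then show ?thesis using finite_V subtree_subset finite_subset by blast
next
  case False
  then have "children T x = {}" using parent_in_V by (auto simp: children_def)
  then show ?thesis by (subst subtree_unfold) simp
qed

text \<open>If \<open>p\<close> were below \<open>c\<close>, the parent chain starting at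
  \<open>c\<close> could never leave the subtree of \<open>c\<close>. The root would then lie in it
  and, having no parent, be \<open>c\<close> itself, which has one.\<close>

lemma parent_notin_subtree:
  assumes "T c = Some p"
  shows "p \<notin> subtree_nodes T c"
proof
  assume p: "p \<in> subtree_nodes T c"
  have "w \<in> subtree_nodes T c" if "c \<in> subtree_nodes T w" for w
  proof -
    have "(\<lambda>u w. T u = Some w)\<^sup>*\<^sup>* c w" using that by (simp add: subtree_nodes_def)
    then show ?thesis
    proof (induction rule: rtranclp_induct)
      case (step y z)
      then show ?case using assms p parent_in_subtree[of y T c z] by (cases "y = c") auto
    qed simp
  qed
  then have "r \<in> subtree_nodes T c"
    using subtree_root child_in_V[OF assms] by blast
  then show False
    using root_None assms subtree_None by fastforce
qed

lemma subtree_antisym: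
  assumes "u \<in> subtree_nodes T v" "v \<in> subtree_nodes T u"
  shows "u = v"
  using assms(1)
proof (cases rule: subtree_cases)
  case (2 p)
  then show ?thesis using assms(2) parent_notin_subtree subtree_trans by metis
qed

lemma siblings_disjoint:
  assumes "T c = Some p" "T d = Some p" "u \<in> subtree_nodes T c" "u \<in> subtree_nodes T d"
  shows "c = d"
proof -
  have *: "c = d" if "c \<in> subtree_nodes T d" "T c = Some p" "T d = Some p" for c d
    using that(1) by (cases rule: subtree_cases) (use that parent_notin_subtree in auto)
  show ?thesis
    using subtree_linear[OF assms(3,4)] * assms(1,2) by metis
qed

lemma finite_boundary: "finite (boundary V E A)"
  unfolding boundary_def using finite_V by simp

text \<open>The edge from \<open>u\<close> into the subtree makes its ends comparable, and
  \<open>u\<close> is outside, so its neighbour \<open>a\<close> lies below \<open>u\<close>. As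
  \<open>a\<close> lies below \<open>x\<close> too, \<open>x\<close> and \<open>u\<close> are
  comparable, with only one order left.\<close>

lemma boundary_ancestor:
  assumes "u \<in> boundary V E (subtree_nodes T x)"
  shows "x \<in> subtree_nodes T u" "u \<noteq> x"
proof -
  obtain a where a: "a \<in> subtree_nodes T x" "E u a" "u \<notin> subtree_nodes T x"
    using assms by (auto simp: boundary_def)
  then have "a \<in> subtree_nodes T u"
    using edge_comparable[OF a(2)] subtree_trans by metis
  with a show "x \<in> subtree_nodes T u" "u \<noteq> x"
    using subtree_linear by fastforce+
qed

text \<open>A path from \<open>x\<close> to \<open>p\<close> inside the subtree of \<open>p\<close>
  must leave the subtree of \<open>x\<close>. The node where it does so is a boundary node, hence a
  proper ancestor of \<open>x\<close> that lies below \<open>p\<close>, and this can only be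
  \<open>p\<close>.\<close>

lemma parent_in_boundary:
  assumes "T x = Some p"
  shows "p \<in> boundary V E (subtree_nodes T x)"
proof (rule ccontr)
  assume p: "p \<notin> boundary V E (subtree_nodes T x)"
  have "reachable_in E (subtree_nodes T p) x p"
    using subtree_connected parent_in_V assms child_in_subtree by metis
  then have "p \<in> subtree_nodes T x"
  proof (rule reachable_in_closed)
    fix a b
    assume a: "a \<in> subtree_nodes T x" and b: "b \<in> subtree_nodes T p" "E a b"
    show "b \<in> subtree_nodes T x"
    proof (rule ccontr)
      assume nb: "b \<notin> subtree_nodes T x"
      with a b have bd: "b \<in> boundary V E (subtree_nodes T x)"
        using edge_sym edge_in_V by (fastforce simp: boundary_def)
      have "p \<in> subtree_nodes T b"
        using boundary_ancestor[OF bd] parent_in_subtree[of x T b p] assms by blast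
      then have "b = p" using b(1) subtree_antisym by blast
      with bd p show False by blast
    qed
  qed simp
  then show False using parent_notin_subtree[OF assms] by blast
qed

text \<open>A boundary node is a proper ancestor of \<open>x\<close>, so it is \<open>p\<close> or
  lies strictly above \<open>p\<close>. In the second case it is also outside the larger subtree of
  \<open>p\<close> and adjacent to it.\<close>

lemma boundary_child_subset:
  assumes "T x = Some p"
  shows "boundary V E (subtree_nodes T x) \<subseteq> insert p (boundary V E (subtree_nodes T p))"
proof
  fix u
  assume u: "u \<in> boundary V E (subtree_nodes T x)"
  then have pu: "p \<in> subtree_nodes T u"
    using boundary_ancestor[OF u] parent_in_subtree[of x T u p] assms by blast
  show "u \<in> insert p (boundary V E (subtree_nodes T p))"
  proof (cases "u = p")
    case False
    then have "u \<notin> subtree_nodes T p" using pu subtree_antisym by blast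
    with u show ?thesis
      using subtree_trans child_in_subtree[of T x p] assms unfolding boundary_def by fast
  qed simp
qed

lemma unique_neighbour_subtree:
  assumes "x \<in> V" "a \<in> subtree_nodes T x" "b \<in> subtree_nodes T x" "z \<notin> subtree_nodes T x"
    "E z a" "E z b"
  shows "a = b"
proof -
  have "reachable_in E (subtree_nodes T x) a b"
    using subtree_connected assms reachable_in_sym reachable_in_trans by metis
  from unique_neighbour[OF this] assms show ?thesis by blast
qed

text \<open>The local conditions give back the recursive definition, by induction on the size of the
  subtree: the subtrees of the children of \<open>x\<close> are connected, and comparability forbids
  edges between them, so they are the components left by \<open>x\<close>.\<close>

lemma search_tree_at:
  assumes "x \<in> V"
  shows "search_tree_at E T (subtree_nodes T x) x"
  using assms
proof (induction "card (subtree_nodes T x)" arbitrary: x rule: less_induct)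
  case less
  let ?A = "subtree_nodes T x - {x}"
  have A: "?A = (\<Union>c\<in>children T x. subtree_nodes T c)"
    using subtree_unfold[of T x] parent_notin_subtree by (auto simp: children_def)
  have comp: "subtree_nodes T c = {v \<in> ?A. reachable_in E ?A u v}"
    if c: "T c = Some x" and u: "u \<in> subtree_nodes T c" for c u
  proof (intro equalityI subsetI)
    fix v assume v: "v \<in> subtree_nodes T c"
    have "reachable_in E (subtree_nodes T c) u v"
      using subtree_connected child_in_V[OF c] u v reachable_in_sym reachable_in_trans by metis
    moreover have "subtree_nodes T c \<subseteq> ?A" using A c by (auto simp: children_def)
    ultimately show "v \<in> {v \<in> ?A. reachable_in E ?A u v}"
      using v reachable_in_mono[of E "subtree_nodes T c" u v ?A] by blast
  next
    fix v assume "v \<in> {v \<in> ?A. reachable_in E ?A u v}"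
    then have "reachable_in E ?A u v" by blast
    then show "v \<in> subtree_nodes T c"
    proof (rule reachable_in_closed)
      fix a b assume ab: "a \<in> subtree_nodes T c" "b \<in> ?A" "E a b"
      then obtain d where d: "T d = Some x" "b \<in> subtree_nodes T d"
        using A by (auto simp: children_def)
      show "b \<in> subtree_nodes T c"
        using edge_comparable[OF ab(3)]
      proof
        assume "a \<in> subtree_nodes T b"
        then have "a \<in> subtree_nodes T d" using d subtree_trans by metis
        then show ?thesis using siblings_disjoint c d ab(1) by blast
      next
        assume "b \<in> subtree_nodes T a"
        then show ?thesis using ab(1) subtree_trans by metis
      qed
    qed (use u in simp)
  qed
  show ?case
  proof (rule search_tree_at.intros)
    show "bij_betw (subtree_nodes T) (children T x) (components E ?A)"
    proof (rule bij_betw_imageI)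
      show "inj_on (subtree_nodes T) (children T x)"
      proof (rule inj_onI)
        fix c d assume "c \<in> children T x" "d \<in> children T x" "subtree_nodes T c = subtree_nodes T d"
        then show "c = d"
          using siblings_disjoint[of c x d c] self_in_subtree[of c T] by (simp add: children_def)
      qed
      show "subtree_nodes T ` children T x = components E ?A"
      proof (intro equalityI subsetI)
        fix B assume "B \<in> subtree_nodes T ` children T x"
        then obtain c where "T c = Some x" "B = subtree_nodes T c" by (auto simp: children_def)
        moreover from this have "c \<in> ?A" using A by (auto simp: children_def)
        ultimately show "B \<in> components E ?A"
          using comp[of c c] unfolding components_def by auto
      next
        fix B assume "B \<in> components E ?A"
        then obtain u where u: "u \<in> ?A" "B = {v \<in> ?A. reachable_in E ?A u v}"
          unfolding components_def by blast
        then obtain c where "T c = Some x" "u \<in> subtree_nodes T c"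
          using A by (auto simp: children_def)
        then show "B \<in> subtree_nodes T ` children T x"
          using comp u(2) by (auto simp: children_def)
      qed
    qed
    show "\<forall>c\<in>children T x. search_tree_at E T (subtree_nodes T c) c"
    proof
      fix c assume "c \<in> children T x"
      then have c: "T c = Some x" by (simp add: children_def)
      have "subtree_nodes T c \<subset> subtree_nodes T x"
        using c parent_notin_subtree[OF c] child_in_subtree[of T c x] subtree_trans[of _ T c x]
          self_in_subtree[of x T] by blast
      then have "card (subtree_nodes T c) < card (subtree_nodes T x)"
        by (simp add: psubset_card_mono subtree_finite)
      then show "search_tree_at E T (subtree_nodes T c) c"
        using less.hyps child_in_V[OF c] by blast
    qed
  qed simp
qed

lemma is_stt: "is_stt V E T"
  unfolding is_stt_def root_of_def
  using dom_T root_in_V root_None search_tree_at[OF root_in_V] subtree_root by metis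

end

section \<open>From the recursive definition to the local conditions\<close>

lemma Union_components: "\<Union>(components E A) = A"
  unfolding components_def using reachable_in_refl[of E A] by blast

lemma search_tree_at_subtree:
  assumes "search_tree_at E T A r"
  shows "A = subtree_nodes T r"
  using assms
proof cases
  case 1
  have "A - {r} = (\<Union>c\<in>children T r. subtree_nodes T c)"
    using 1(2) Union_components[of E "A - {r}"] unfolding bij_betw_def by simp
  then show ?thesis using insert_Diff[OF 1(1)] subtree_unfold[of T r] by simp
qed

context unrooted_tree
begin

text \<open>Components are defined by paths in \<open>A\<close>. Such a path, started in a
  component, never leaves it, so it is also a path in \<open>B\<close>.\<close>

lemma component_connected:
  assumes "B \<in> components E A" "u \<in> B" "v \<in> B"
  shows "reachable_in E B u v"
proof -
  obtain w where w: "w \<in> A" "B = {v \<in> A. reachable_in E A w v}"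
    using assms(1) unfolding components_def by blast
  have "reachable_in E B w x" if "x \<in> B" for x
  proof -
    have "reachable_in E A w x" using that w by blast
    then have "reachable_in E B w x \<and> x \<in> B"
      unfolding reachable_in_def
    proof (induction rule: rtranclp_induct)
      case base
      then show ?case using w by simp
    next
      case (step y z)
      then have "z \<in> B" using w(2) by (auto simp: reachable_in_def intro: rtranclp.rtrancl_into_rtrancl)
      with step show ?case by (auto intro: rtranclp.rtrancl_into_rtrancl)
    qed
    then show ?thesis ..
  qed
  then show ?thesis
    using assms(2,3) reachable_in_sym reachable_in_trans by metis
qed

lemma component_edge:
  assumes "u \<in> A" "v \<in> A" "E u v"
  shows "\<exists>B \<in> components E A. u \<in> B \<and> v \<in> B"
  using assms reachable_in_edge[of u A v E] unfolding components_def
  by (intro bexI[of _ "{v \<in> A. reachable_in E A u v}"]) auto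

text \<open>The connectedness assumption passes to the children because their subtrees are
  components. An edge that avoids \<open>r\<close> stays within one component, where the induction
  hypothesis applies.\<close>

lemma search_tree_at_properties:
  assumes "search_tree_at E T A r" "\<And>u. u \<in> A \<Longrightarrow> reachable_in E A u r"
  shows "(\<forall>x\<in>A. \<forall>u\<in>subtree_nodes T x. reachable_in E (subtree_nodes T x) u x) \<and>
    (\<forall>u\<in>A. \<forall>v\<in>A. E u v \<longrightarrow> u \<in> subtree_nodes T v \<or> v \<in> subtree_nodes T u)"
  using assms
proof (induction rule: search_tree_at.induct)
  case (1 r A)
  have A: "A = subtree_nodes T r"
  proof (rule search_tree_at_subtree)
    show "search_tree_at E T A r" by (rule search_tree_at.intros) (use 1 in auto)
  qed
  have un: "A = insert r (\<Union>c\<in>children T r. subtree_nodes T c)"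
    unfolding A by (rule subtree_unfold)
  have comp: "subtree_nodes T c \<in> components E (A - {r})" if "c \<in> children T r" for c
    using that 1(2) unfolding bij_betw_def by auto
  have IH: "(\<forall>x\<in>subtree_nodes T c. \<forall>u\<in>subtree_nodes T x. reachable_in E (subtree_nodes T x) u x) \<and>
    (\<forall>u\<in>subtree_nodes T c. \<forall>v\<in>subtree_nodes T c.
      E u v \<longrightarrow> u \<in> subtree_nodes T v \<or> v \<in> subtree_nodes T u)" if "c \<in> children T r" for c
  proof -
    have "reachable_in E (subtree_nodes T c) u c" if "u \<in> subtree_nodes T c" for u
      using component_connected[OF comp[OF \<open>c \<in> children T r\<close>]] that by simp
    with 1(3) that show ?thesis by blast
  qed
  show ?case
  proof (intro conjI ballI impI)
    fix x u assume "x \<in> A" "u \<in> subtree_nodes T x"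
    then show "reachable_in E (subtree_nodes T x) u x"
      using un IH 1(4) A by (cases "x = r") auto
  next
    fix u v assume uv: "u \<in> A" "v \<in> A" "E u v"
    show "u \<in> subtree_nodes T v \<or> v \<in> subtree_nodes T u"
    proof (cases "u = r \<or> v = r")
      case True
      then show ?thesis using uv A by auto
    next
      case False
      then obtain B where B: "B \<in> components E (A - {r})" "u \<in> B" "v \<in> B"
        using component_edge[of u "A - {r}" v] uv by auto
      then obtain c where "c \<in> children T r" "B = subtree_nodes T c"
        using 1(2) unfolding bij_betw_def by auto
      then show ?thesis using IH B uv by blast
    qed
  qed
qed

lemma is_stt_iff: "is_stt V E T \<longleftrightarrow> (\<exists>r. search_tree V E T r)"
proof
  assume "is_stt V E T"
  then obtain r where r: "dom T \<subseteq> V" "r \<in> V" "T r = None" "search_tree_at E T V r"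
    unfolding is_stt_def root_of_def by blast
  have V: "subtree_nodes T r = V" using search_tree_at_subtree[OF r(4)] by simp
  have "search_tree V E T r"
  proof
    show "reachable_in E (subtree_nodes T x) u x" if "x \<in> V" "u \<in> subtree_nodes T x" for x u
      using search_tree_at_properties[OF r(4)] connected_V r(2) that by blast
    show "u \<in> subtree_nodes T v \<or> v \<in> subtree_nodes T u" if "E u v" for u v
      using search_tree_at_properties[OF r(4)] connected_V r(2) that edge_in_V[OF that] by blast
  qed (use r V in auto)
  then show "\<exists>r. search_tree V E T r" ..
qed (auto intro: search_tree.is_stt)

end

section \<open>Rotations\<close>

locale rotation = search_tree V E T r for V :: "'a set" and E T r +
  fixes x p :: 'a
  assumes parent_x: "T x = Some p"
begin

text \<open>A set although it has at most one element (\<open>moved_unique\<close>), so that unions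
  over it also cover the case where no child changes its parent.\<close>

definition moved :: "'a set" where
  "moved = {y \<in> children T x. \<exists>u\<in>subtree_nodes T y. E p u}"

text \<open>This becomes the node set of the subtree of \<open>p\<close> after the rotation.\<close>

definition lower :: "'a set" where
  "lower = (subtree_nodes T p - subtree_nodes T x) \<union> (\<Union>y\<in>moved. subtree_nodes T y)"

definition rotated :: "'a rooted_tree" where
  "rotated = (\<lambda>v. if v = x then T p
                  else if v = p then Some x
                  else if v \<in> children T x \<and> (\<exists>u\<in>subtree_nodes T v. E p u) then Some p
                  else T v)"

lemma rotated_simps:
  "rotated x = T p" "rotated p = Some x" "v \<in> moved \<Longrightarrow> rotated v = Some p"
  "v \<noteq> x \<Longrightarrow> v \<noteq> p \<Longrightarrow> v \<notin> moved \<Longrightarrow> rotated v = T v"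
proof -
  have "x \<noteq> p" "\<And>v. v \<in> children T x \<Longrightarrow> v \<noteq> x \<and> v \<noteq> p"
    using parent_notin_subtree[OF parent_x] parent_notin_subtree[of _ x] parent_x
      child_in_subtree[of T p x]
    by (auto simp: children_def)
  then show "rotated x = T p" "rotated p = Some x" "v \<in> moved \<Longrightarrow> rotated v = Some p"
    "v \<noteq> x \<Longrightarrow> v \<noteq> p \<Longrightarrow> v \<notin> moved \<Longrightarrow> rotated v = T v"
    by (auto simp: rotated_def moved_def)
qed

lemma moved_child: "y \<in> moved \<Longrightarrow> T y = Some x"
  by (simp add: moved_def children_def)

lemma x_in_V: "x \<in> V" and p_in_V: "p \<in> V"
  using child_in_V parent_in_V parent_x by auto

lemma x_neq_p: "x \<noteq> p"
  using parent_notin_subtree[OF parent_x] by auto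

lemma subtree_x_subset: "subtree_nodes T x \<subseteq> subtree_nodes T p"
  using subtree_trans[of _ T x p] child_in_subtree[of T x p] parent_x by auto

lemma subtree_moved_subset: "y \<in> moved \<Longrightarrow> subtree_nodes T y \<subseteq> subtree_nodes T x - {x}"
  using subtree_trans[of _ T y x] child_in_subtree[of T y x] moved_child[of y]
    parent_notin_subtree[of y x] by auto

lemma x_notin_lower: "x \<notin> lower"
  unfolding lower_def using subtree_moved_subset by auto

lemma p_in_lower: "p \<in> lower"
  unfolding lower_def using parent_notin_subtree[OF parent_x] by auto

lemma lower_subset: "lower \<subseteq> subtree_nodes T p"
  unfolding lower_def using subtree_moved_subset subtree_x_subset by auto

lemma lower_unfold:
  "lower = insert p ((\<Union>c\<in>children T p - {x}. subtree_nodes T c) \<union> (\<Union>y\<in>moved. subtree_nodes T y))"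
proof -
  have "subtree_nodes T p - subtree_nodes T x = insert p (\<Union>c\<in>children T p - {x}. subtree_nodes T c)"
  proof (intro equalityI subsetI)
    fix u assume "u \<in> subtree_nodes T p - subtree_nodes T x"
    then show "u \<in> insert p (\<Union>c\<in>children T p - {x}. subtree_nodes T c)"
      using subtree_unfold[of T p] by auto
  next
    fix u assume "u \<in> insert p (\<Union>c\<in>children T p - {x}. subtree_nodes T c)"
    then show "u \<in> subtree_nodes T p - subtree_nodes T x"
      using parent_notin_subtree[OF parent_x] siblings_disjoint[of _ p x u] parent_x
        subtree_unfold[of T p] by (auto simp: children_def)
  qed
  then show ?thesis unfolding lower_def by blast
qed

lemma subtree_x_unfold:
  "subtree_nodes T p = insert x (lower \<union> (\<Union>y\<in>children T x - moved. subtree_nodes T y))"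
proof -
  have "subtree_nodes T x = insert x ((\<Union>y\<in>moved. subtree_nodes T y) \<union> (\<Union>y\<in>children T x - moved. subtree_nodes T y))"
    unfolding subtree_unfold[of T x] by (auto simp: moved_def)
  then show ?thesis using subtree_x_subset unfolding lower_def by blast
qed

lemma children_rotated:
  "children rotated x = insert p (children T x - moved)"
  "children rotated p = (children T p - {x}) \<union> moved"
  "v \<noteq> x \<Longrightarrow> v \<noteq> p \<Longrightarrow>
    children rotated v = (if p \<in> children T v then insert x (children T v - {p}) else children T v)"
proof -
  have *: "T p \<noteq> Some x" "T p \<noteq> Some p" "T x \<noteq> Some x" 
    using parent_notin_subtree[of p x] parent_notin_subtree[of p p] parent_notin_subtree[of x x]
      child_in_subtree[of T p x] parent_notin_subtree[OF parent_x] by auto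
  have mv: "T u = Some x" "u \<noteq> x" "u \<noteq> p" if "u \<in> moved" for u
    using that moved_child[of u] * by auto
  have eq: "u \<in> children rotated v \<longleftrightarrow> (if u = x then T p = Some v else if u = p then v = x
      else if u \<in> moved then v = p else T u = Some v)" for u v
    using rotated_simps(1,2) rotated_simps(3,4)[of u] mv(2,3)[of u] by (auto simp: children_def)
  show "children rotated x = insert p (children T x - moved)"
    using x_neq_p * by (intro set_eqI) (auto simp: eq, auto simp: children_def)
  show "children rotated p = (children T p - {x}) \<union> moved"
  proof (rule set_eqI)
    fix u
    show "u \<in> children rotated p \<longleftrightarrow> u \<in> (children T p - {x}) \<union> moved"
      using x_neq_p * mv[of u] by (simp add: eq) (auto simp: children_def)
  qed
  assume v: "v \<noteq> x" "v \<noteq> p"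
  show "children rotated v = (if p \<in> children T v then insert x (children T v - {p}) else children T v)"
  proof (rule set_eqI)
    fix u
    show "u \<in> children rotated v \<longleftrightarrow>
      u \<in> (if p \<in> children T v then insert x (children T v - {p}) else children T v)"
      using v x_neq_p parent_x mv[of u] by (simp add: eq) (auto simp: children_def)
  qed
qed

text \<open>Only the node sets of \<open>x\<close> and \<open>p\<close> change. The claimed family
  is checked against the recursive equation in \<open>subtree_nodes_eqI\<close>, one kind of node at
  a time.\<close>

lemma subtree_rotated:
  "subtree_nodes rotated = (\<lambda>v. if v = x then subtree_nodes T p else if v = p then lower else subtree_nodes T v)"
    (is "_ = ?N")
proof -
  define N where "N = ?N"
  have N_simps: "N x = subtree_nodes T p" "N p = lower"
    "v \<noteq> x \<Longrightarrow> v \<noteq> p \<Longrightarrow> N v = subtree_nodes T v" for v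
    unfolding N_def using x_neq_p by auto
  have "subtree_nodes rotated = N"
  proof (rule subtree_nodes_eqI)
    fix v
    show "N v = insert v (\<Union>c\<in>children rotated v. N c)"
    proof -
      consider "v = x" | "v = p" | "v \<noteq> x" "v \<noteq> p" by blast
      then show ?thesis
      proof cases
        case 1
        have "\<And>y. y \<in> children T x - moved \<Longrightarrow> y \<noteq> x \<and> y \<noteq> p"
          using parent_notin_subtree[of _ x] parent_notin_subtree[OF parent_x] child_in_subtree[of T _ x]
          by (auto simp: children_def)
        then have "(\<Union>y\<in>children T x - moved. N y) = (\<Union>y\<in>children T x - moved. subtree_nodes T y)"
          by (intro SUP_cong refl N_simps(3)) blast+
        then show ?thesis
          using 1 subtree_x_unfold x_neq_p by (simp add: children_rotated N_simps)
      next
        case 2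
        have "y \<noteq> x \<and> y \<noteq> p" if "y \<in> (children T p - {x}) \<union> moved" for y
          using that parent_notin_subtree[of y p] moved_child[of y] parent_notin_subtree[of y x]
            child_in_subtree[of T x p] parent_notin_subtree[OF parent_x] child_in_subtree[of T y x] parent_x
          by (auto simp: children_def)
        then have "(\<Union>y\<in>(children T p - {x}) \<union> moved. N y) = (\<Union>y\<in>(children T p - {x}) \<union> moved. subtree_nodes T y)"
          by (intro SUP_cong refl N_simps(3)) blast+
        then show ?thesis
          using 2 lower_unfold x_neq_p by (simp add: children_rotated N_simps UN_Un)
      next
        case 3
        have x: "x \<notin> children T v" using 3 parent_x by (simp add: children_def)
        show ?thesis
        proof (cases "p \<in> children T v")
          case True
          have "(\<Union>c\<in>children T v - {p}. N c) = (\<Union>c\<in>children T v - {p}. subtree_nodes T c)"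
            using x by (intro SUP_cong refl N_simps(3)) blast+
          moreover have "(\<Union>c\<in>children T v. subtree_nodes T c) =
              subtree_nodes T p \<union> (\<Union>c\<in>children T v - {p}. subtree_nodes T c)"
            using True by blast
          ultimately show ?thesis
            using 3 True subtree_unfold[of T v] by (simp add: children_rotated N_simps)
        next
          case False
          have "(\<Union>c\<in>children T v. N c) = (\<Union>c\<in>children T v. subtree_nodes T c)"
            using x False by (intro SUP_cong refl N_simps(3)) blast+
          then show ?thesis
            using 3 False subtree_unfold[of T v] by (simp add: children_rotated N_simps)
        qed
      qed
    qed
  next
    fix c v assume c: "rotated c = Some v"
    consider "c = x" | "c = p" | "c \<in> moved" | "c \<noteq> x" "c \<noteq> p" "c \<notin> moved" by blast
    then show "v \<notin> N c"
    proof cases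
      case 1
      then show ?thesis using c N_simps rotated_simps parent_notin_subtree[of p v] by auto
    next
      case 2
      then show ?thesis using c N_simps rotated_simps x_notin_lower x_neq_p by auto
    next
      case 3
      then have "v = p" "c \<noteq> x" "c \<noteq> p" using c N_simps rotated_simps x_neq_p moved_child parent_x by fastforce+
      then show ?thesis
        using N_simps subtree_moved_subset[OF 3] parent_notin_subtree[OF parent_x] by auto
    next
      case 4
      then show ?thesis using c N_simps rotated_simps parent_notin_subtree[of c v] by auto
    qed
  next
    fix v show "finite (N v)"
      unfolding N_def using subtree_finite finite_subset[OF lower_subset subtree_finite] by auto
  qed
  then show ?thesis unfolding N_def .
qed

lemma subtree_rotated_simps:
  "subtree_nodes rotated x = subtree_nodes T p"
  "subtree_nodes rotated p = lower"
  "v \<noteq> x \<Longrightarrow> v \<noteq> p \<Longrightarrow> subtree_nodes rotated v = subtree_nodes T v"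
  using x_neq_p by (auto simp: subtree_rotated)

text \<open>Each piece hanging below \<open>p\<close> is a connected subtree that contains a
  neighbour of \<open>p\<close>: for the old children by \<open>parent_in_boundary\<close>, for a
  moved child by the definition of \<open>moved\<close>.\<close>

lemma lower_connected:
  assumes "u \<in> lower"
  shows "reachable_in E lower u p"
proof -
  have *: "reachable_in E lower u p"
    if c: "c \<in> V" "u \<in> subtree_nodes T c" "subtree_nodes T c \<subseteq> lower" and a: "a \<in> subtree_nodes T c" "E p a" for c a
  proof -
    have "reachable_in E (subtree_nodes T c) u a"
      using subtree_connected[OF c(1)] c(2) a(1) reachable_in_sym[of "subtree_nodes T c" a c]
        reachable_in_trans[of E "subtree_nodes T c" u c a] by blast
    then have "reachable_in E lower u a"
      using c(3) by (rule reachable_in_mono)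
    moreover have "reachable_in E lower a p"
      using reachable_in_edge[of a lower p E] a c(3) p_in_lower edge_sym by blast
    ultimately show ?thesis by (rule reachable_in_trans)
  qed
  consider "u = p" | c where "T c = Some p" "c \<noteq> x" "u \<in> subtree_nodes T c"
    | y where "y \<in> moved" "u \<in> subtree_nodes T y"
    using assms by (auto simp: lower_unfold children_def)
  then show ?thesis
  proof cases
    case 1
    then show ?thesis by simp
  next
    case 2
    from parent_in_boundary[OF 2(1)] obtain a where "a \<in> subtree_nodes T c" "E p a"
      by (auto simp: boundary_def)
    moreover have "subtree_nodes T c \<subseteq> lower"
      using 2 by (auto simp: lower_unfold children_def)
    ultimately show ?thesis using * child_in_V 2 by blast
  next
    case 3
    then obtain a where "a \<in> subtree_nodes T y" "E p a" by (auto simp: moved_def)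
    moreover have "subtree_nodes T y \<subseteq> lower"
      using 3 by (auto simp: lower_unfold)
    ultimately show ?thesis using * 3 child_in_V[of y x] moved_child[of y] by blast
  qed
qed

text \<open>The critical case is \<open>v = p\<close>. Apart from \<open>x\<close>, the nodes that
  \<open>p\<close> loses lie below children of \<open>x\<close> that are not moved, and those
  subtrees contain no neighbour of \<open>p\<close>.\<close>

lemma edge_comparable_rotated:
  assumes "E u v" "u \<in> subtree_nodes T v"
  shows "u \<in> subtree_nodes rotated v \<or> v \<in> subtree_nodes rotated u"
proof -
  consider "v = x" | "v = p" "u = x" | "v = p" "u \<noteq> x" | "v \<noteq> x" "v \<noteq> p" by blast
  then show ?thesis
  proof cases
    case 1
    then show ?thesis using assms subtree_x_subset subtree_rotated_simps by auto
  next
    case 2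
    then show ?thesis using subtree_rotated_simps by simp
  next
    case 3
    have "u \<in> lower"
    proof (rule ccontr)
      assume "u \<notin> lower"
      then obtain y where "y \<in> children T x - moved" "u \<in> subtree_nodes T y"
        using assms(2) 3 subtree_x_unfold by auto
      then show False using assms(1) 3 edge_sym[OF assms(1)] by (auto simp: moved_def)
    qed
    then show ?thesis using 3 subtree_rotated_simps by simp
  next
    case 4
    then show ?thesis using assms subtree_rotated_simps by simp
  qed
qed

lemma search_tree_rotated: "search_tree V E rotated (if p = r then x else r)"
proof
  show "dom rotated \<subseteq> V"
    using child_in_V x_in_V p_in_V by (auto simp: rotated_def children_def split: if_splits)
  show "(if p = r then x else r) \<in> V" using root_in_V x_in_V by simp
  show "rotated (if p = r then x else r) = None"
  proof (cases "p = r")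
    case True
    then show ?thesis using rotated_simps root_None by simp
  next
    case False
    moreover have "r \<noteq> x" "r \<notin> moved" using root_None parent_x moved_child by auto
    ultimately show ?thesis using rotated_simps(4) root_None by simp
  qed
  show "subtree_nodes rotated (if p = r then x else r) = V"
    using subtree_root subtree_rotated_simps(1) subtree_rotated_simps(3)[of r] root_None parent_x
    by (cases "r = x") auto
  show "reachable_in E (subtree_nodes rotated v) u v" if v: "v \<in> V" "u \<in> subtree_nodes rotated v" for u v
  proof -
    consider "v = x" | "v = p" | "v \<noteq> x" "v \<noteq> p" by blast
    then show ?thesis
    proof cases
      case 1
      \<comment> \<open>The subtree of \<open>x\<close> is now the old subtree of \<open>p\<close>,
        so the path from \<open>u\<close> is led through \<open>p\<close> to
        \<open>x\<close>.\<close>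
      have "reachable_in E (subtree_nodes T p) u p" "reachable_in E (subtree_nodes T p) x p"
        using subtree_connected[OF p_in_V] v(2) 1 child_in_subtree[of T x p] parent_x
          subtree_rotated_simps by auto
      then show ?thesis
        using 1 subtree_rotated_simps reachable_in_sym reachable_in_trans by metis
    next
      case 2
      then show ?thesis using v lower_connected subtree_rotated_simps by simp
    next
      case 3
      then show ?thesis using v subtree_connected subtree_rotated_simps by simp
    qed
  qed
  show "u \<in> subtree_nodes rotated v \<or> v \<in> subtree_nodes rotated u" if "E u v" for u v
    using edge_comparable[OF that] edge_comparable_rotated[of u v] edge_comparable_rotated[of v u]
      that edge_sym[OF that] by blast
qed

lemma rotation_at_rotated: "rotation_at E x T rotated"
  unfolding rotation_at_def rotated_def using parent_x by blast

lemma rotation_at_iff: "rotation_at E x T T' \<longleftrightarrow> T' = rotated"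
  unfolding rotation_at_def rotated_def using parent_x by simp

text \<open>Exactly the moved subtrees return. A moved child had parent \<open>x\<close>, so its
  subtree contains a neighbour of \<open>x\<close>. An old child of \<open>p\<close> is a sibling of
  \<open>x\<close>, so nothing below it is comparable, hence adjacent, to \<open>x\<close>.\<close>

lemma rotation_at_inverse: "rotation_at E p rotated T"
proof -
  have "T v = (if v = p then rotated x else if v = x then Some p
      else if v \<in> children rotated p \<and> (\<exists>u\<in>subtree_nodes rotated v. E x u) then Some x
      else rotated v)" for v
  proof -
    consider "v = p \<or> v = x" | "v \<in> moved" "v \<noteq> x" "v \<noteq> p" | "v \<in> children T p" "v \<notin> moved" "v \<noteq> x" "v \<noteq> p"
      | "v \<notin> children T p" "v \<notin> moved" "v \<noteq> x" "v \<noteq> p" by blast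
    then show ?thesis
    proof cases
      case 1
      then show ?thesis using rotated_simps parent_x by auto
    next
      case 2
      have "T v = Some x" using 2 moved_child by blast
      moreover from parent_in_boundary[OF this] have "\<exists>u\<in>subtree_nodes T v. E x u"
        by (auto simp: boundary_def)
      ultimately show ?thesis using 2 by (simp add: children_rotated subtree_rotated_simps)
    next
      case 3
      have "\<not> E x u" if u: "u \<in> subtree_nodes T v" for u
      proof
        assume "E x u"
        then consider "x \<in> subtree_nodes T u" | "u \<in> subtree_nodes T x" using edge_comparable by blast
        then have "\<exists>w. w \<in> subtree_nodes T x \<and> w \<in> subtree_nodes T v"
          using u self_in_subtree[of x T] subtree_trans[of x T u v] by cases blast+
        then show False
          using 3 parent_x siblings_disjoint[of x p v] by (auto simp: children_def)
      qed
      with 3 show ?thesis by (simp add: subtree_rotated_simps rotated_simps)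
    next
      case 4
      then show ?thesis by (simp add: children_rotated rotated_simps)
    qed
  qed
  then show ?thesis
    unfolding rotation_at_def using rotated_simps(2) by blast
qed

end

section \<open>The effect of a rotation on the boundaries\<close>

abbreviation (in unrooted_tree) width :: "'a rooted_tree \<Rightarrow> 'a \<Rightarrow> nat" where
  "width T v \<equiv> card (boundary V E (subtree_nodes T v))"

definition (in unrooted_tree) weight :: "'a rooted_tree \<Rightarrow> nat" where
  "weight T = (\<Sum>v\<in>V. width T v)"

context rotation
begin

text \<open>This is \<open>boundary_child_subset\<close> in the rotated tree, where \<open>p\<close>
  is a child of \<open>x\<close> and \<open>x\<close> owns the old node set of
  \<open>p\<close>.\<close>

lemma boundary_lower_subset: "boundary V E lower \<subseteq> insert x (boundary V E (subtree_nodes T p))"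
proof -
  interpret R: search_tree V E rotated "if p = r then x else r" by (rule search_tree_rotated)
  show ?thesis
    using R.boundary_child_subset[OF rotated_simps(2)] by (simp add: subtree_rotated_simps)
qed

text \<open>\<open>p\<close> lies outside the connected subtree of \<open>x\<close>, so it has at
  most one neighbour there.\<close>

lemma moved_unique:
  assumes "y \<in> moved" "z \<in> moved"
  shows "y = z"
proof -
  obtain a b where ab: "a \<in> subtree_nodes T y" "E p a" "b \<in> subtree_nodes T z" "E p b"
    using assms by (auto simp: moved_def)
  then have "a = b"
    using unique_neighbour_subtree[OF x_in_V, of a b p] subtree_moved_subset[OF assms(1)]
      subtree_moved_subset[OF assms(2)] parent_notin_subtree[OF parent_x] by blast
  then show ?thesis
    using siblings_disjoint[of y x z a] ab moved_child assms by blast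
qed

lemma width_lower_less:
  assumes max: "\<And>v. v \<in> V \<Longrightarrow> width T v \<le> m" and x: "width T x = m" and p: "width T p < m" and m: "2 \<le> m"
  shows "card (boundary V E lower) < m"
proof -
  \<comment> \<open>In the inclusion of \<open>boundary_child_subset\<close> the smaller set has
    \<open>m\<close> elements and the larger at most \<open>m\<close>, so both agree. Hence every
    boundary node of the subtree of \<open>p\<close> has a neighbour below \<open>x\<close>.\<close>
  have "card (insert p (boundary V E (subtree_nodes T p))) \<le> m"
    using p card_insert_le_m1[of m "boundary V E (subtree_nodes T p)" p] m by simp
  then have bd_x: "boundary V E (subtree_nodes T x) = insert p (boundary V E (subtree_nodes T p))"
    using boundary_child_subset[OF parent_x] x finite_boundary
    by (intro card_seteq) auto
  have *: "\<exists>y\<in>moved. z \<in> boundary V E (subtree_nodes T y) - {p, x}"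
    if z: "z \<in> boundary V E lower" "z \<noteq> x" for z
  proof -
    have zp: "z \<in> boundary V E (subtree_nodes T p)" using z boundary_lower_subset by blast
    then have "z \<in> boundary V E (subtree_nodes T x)" using bd_x by blast
    then obtain a where a: "a \<in> subtree_nodes T x" "E z a" by (auto simp: boundary_def)
    obtain b where b: "b \<in> lower" "E z b" using z by (auto simp: boundary_def)
    have znp: "z \<notin> subtree_nodes T p" "z \<in> V" using zp by (auto simp: boundary_def)
    \<comment> \<open>\<open>z\<close> has one neighbour below \<open>x\<close> and one in
      \<open>lower\<close>. Both lie in the subtree of \<open>p\<close>, so they coincide, and a
      node in both sets lies in a moved subtree.\<close>
    have "a = b"
      using unique_neighbour_subtree[OF p_in_V, of a b z] a b znp lower_subset subtree_x_subset by blast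
    then obtain y where y: "y \<in> moved" "a \<in> subtree_nodes T y"
      using a(1) b(1) by (auto simp: lower_def)
    moreover have "subtree_nodes T y \<subseteq> subtree_nodes T p"
      using subtree_moved_subset[OF y(1)] subtree_x_subset by blast
    moreover have "z \<noteq> p" using znp by auto
    ultimately show ?thesis
      using a(2) znp z(2) by (auto simp: boundary_def)
  qed
  show ?thesis
  proof (cases "moved = {}")
    case True
    then have "boundary V E lower \<subseteq> {x}" using * by blast
    then have "card (boundary V E lower) \<le> 1" using card_mono[of "{x}"] by fastforce
    then show ?thesis using m by simp
  next
    case False
    then obtain y where y: "y \<in> moved" by blast
    let ?B = "boundary V E (subtree_nodes T y)"
    have "boundary V E lower \<subseteq> insert x (?B - {p, x})"
      using * moved_unique[OF y] by blast
    then have "card (boundary V E lower) \<le> card (insert x (?B - {p, x}))"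
      using finite_boundary by (intro card_mono) auto
    also have "\<dots> \<le> Suc (card (?B - {p, x}))" by (rule card_insert_le_m1) auto
    \<comment> \<open>The boundary of the moved subtree has at most \<open>m\<close> nodes. Taking
      away \<open>p\<close> and \<open>x\<close> and putting \<open>x\<close> back leaves at most
      \<open>m - 1\<close>.\<close>
    also have "{p, x} \<subseteq> ?B"
    proof -
      have "x \<in> ?B" using parent_in_boundary moved_child[OF y] by blast
      moreover have "p \<notin> subtree_nodes T y"
        using subtree_moved_subset[OF y] parent_notin_subtree[OF parent_x] by blast
      then have "p \<in> ?B" using y p_in_V by (auto simp: moved_def boundary_def)
      ultimately show ?thesis by blast
    qed
    then have "card (?B - {p, x}) = card ?B - 2"
      using x_neq_p by (simp add: card_Diff_subset)
    finally show ?thesis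
      using max[of y] m child_in_V[OF moved_child[OF y]] by simp
  qed
qed

lemma width_rotated:
  "width rotated x = width T p" "width rotated p = card (boundary V E lower)"
  "v \<noteq> x \<Longrightarrow> v \<noteq> p \<Longrightarrow> width rotated v = width T v"
  by (simp_all add: subtree_rotated_simps)

text \<open>\<open>x\<close> takes over the width of \<open>p\<close>, so in total the old width of
  \<open>x\<close> is exchanged for that of \<open>lower\<close>. The additive form avoids
  subtraction of natural numbers.\<close>

lemma weight_rotated: "weight rotated + width T x = weight T + card (boundary V E lower)"
proof -
  have split: "weight U = width U x + (width U p + (\<Sum>v\<in>V - {x} - {p}. width U v))" for U
    unfolding weight_def using x_in_V p_in_V x_neq_p finite_V
    by (simp add: sum.remove[of V x] sum.remove[of "V - {x}" p])
  have "(\<Sum>v\<in>V - {x} - {p}. width rotated v) = (\<Sum>v\<in>V - {x} - {p}. width T v)"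
    by (intro sum.cong refl) (simp add: width_rotated)
  then show ?thesis
    using split[of T] split[of rotated] by (simp add: width_rotated)
qed

end

section \<open>Walks of the pointer\<close>

lemma k_cut_mono: "k_cut k V E T \<Longrightarrow> k \<le> l \<Longrightarrow> k_cut l V E T"
  unfolding k_cut_def using le_trans by blast

lemma relpowp_trans: "(R ^^ m) x y \<Longrightarrow> (R ^^ n) y z \<Longrightarrow> (R ^^ (m + n)) x z"
  unfolding relpowp_add by blast

context unrooted_tree
begin

text \<open>Both trees are required to be \<open>k\<close>-cut, so that powers of the relation carry
  the claim about intermediate trees.\<close>

definition cut_rotation :: "nat \<Rightarrow> 'a rooted_tree \<Rightarrow> 'a rooted_tree \<Rightarrow> bool" where
  "cut_rotation k T T' \<longleftrightarrow> k_cut k V E T \<and> k_cut k V E T' \<and> (\<exists>x\<in>V. rotation_at E x T T')"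

definition cut_step :: "nat \<Rightarrow> 'a rooted_tree \<times> 'a \<Rightarrow> 'a rooted_tree \<times> 'a \<Rightarrow> bool" where
  "cut_step k c d \<longleftrightarrow> k_cut k V E (fst c) \<and> k_cut k V E (fst d) \<and> pointer_step E c d"

text \<open>Rotations are counted exactly and pointer steps only bounded, as two separate sequences
  between the same trees. Reversal keeps the first count but multiplies the second bound by
  3.\<close>

definition walk :: "nat \<Rightarrow> nat \<Rightarrow> nat \<Rightarrow> 'a rooted_tree \<times> 'a \<Rightarrow> 'a rooted_tree \<times> 'a \<Rightarrow> bool" where
  "walk k i s c d \<longleftrightarrow>
     (cut_rotation k ^^ i) (fst c) (fst d) \<and> (\<exists>s'\<le>s. (cut_step k ^^ s') c d)"

lemma walk_refl: "walk k 0 0 c c"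
  unfolding walk_def by simp

lemma walk_trans: "walk k i s c d \<Longrightarrow> walk k j t d e \<Longrightarrow> walk k (i + j) (s + t) c e"
  unfolding walk_def by (meson relpowp_trans add_le_mono)

lemma walk_mono: "walk k i s c d \<Longrightarrow> s \<le> t \<Longrightarrow> walk k i t c d"
  unfolding walk_def using le_trans by blast

lemma walk_parent:
  assumes "k_cut k V E T" "T x = Some p"
  shows "walk k 0 1 (T, x) (T, p)"
proof -
  have "(cut_step k ^^ 1) (T, x) (T, p)"
    unfolding relpowp_1 cut_step_def using assms by (simp add: pointer_step.to_parent)
  then show ?thesis unfolding walk_def by (intro conjI exI[of _ 1]) simp_all
qed

lemma walk_child:
  assumes "k_cut k V E T" "T x = Some p"
  shows "walk k 0 1 (T, p) (T, x)"
proof -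
  have "(cut_step k ^^ 1) (T, p) (T, x)"
    unfolding relpowp_1 cut_step_def using assms by (simp add: pointer_step.to_child children_def)
  then show ?thesis unfolding walk_def by (intro conjI exI[of _ 1]) simp_all
qed

lemma k_cut_search_tree: "k_cut k V E T \<Longrightarrow> \<exists>r. search_tree V E T r"
  unfolding k_cut_def is_stt_iff by blast

lemma rotationE:
  assumes "k_cut k V E T" "rotation_at E x T T'"
  obtains r p where "rotation V E T r x p" "T' = rotation.rotated E T x p"
proof -
  obtain r where r: "search_tree V E T r" using assms(1) k_cut_search_tree by blast
  obtain p where p: "T x = Some p" using assms(2) unfolding rotation_at_def by blast
  interpret rotation V E T r x p
    using r p by (simp add: rotation_def rotation_axioms_def)
  show ?thesis using that rotation_axioms rotation_at_iff assms(2) by blast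
qed

lemma walk_rotate:
  assumes "k_cut k V E T" "k_cut k V E T'" "rotation_at E x T T'"
  shows "walk k 1 1 (T, x) (T', x)"
proof -
  obtain r p where "rotation V E T r x p" using rotationE[OF assms(1,3)] by blast
  then interpret rotation V E T r x p .
  have "(cut_rotation k ^^ 1) T T'"
    unfolding relpowp_1 cut_rotation_def using assms x_in_V by blast
  moreover have "(cut_step k ^^ 1) (T, x) (T', x)"
    unfolding relpowp_1 cut_step_def using assms by (simp add: pointer_step.rotate)
  ultimately show ?thesis unfolding walk_def by (intro conjI exI[of _ 1]) simp_all
qed

lemma cut_rotation_sym:
  assumes "cut_rotation k T T'"
  shows "cut_rotation k T' T"
proof -
  obtain x where x: "k_cut k V E T" "k_cut k V E T'" "rotation_at E x T T'"
    using assms unfolding cut_rotation_def by blast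
  then obtain r p where rp: "rotation V E T r x p" "T' = rotation.rotated E T x p"
    using rotationE by blast
  then interpret rotation V E T r x p by simp
  show ?thesis
    using x rp(2) rotation_at_inverse p_in_V unfolding cut_rotation_def by blast
qed

text \<open>
  A rotation at \<open>x\<close> with parent \<open>p\<close> is undone by moving the pointer down to \<open>p\<close>, rotating at \<open>p\<close>,
  and moving the pointer down to \<open>x\<close>.
\<close>

lemma cut_step_reverse:
  assumes "cut_step k c d"
  shows "\<exists>s\<le>3. (cut_step k ^^ s) d c"
proof -
  have k: "k_cut k V E (fst c)" "k_cut k V E (fst d)" and "pointer_step E c d"
    using assms unfolding cut_step_def by auto
  from this(3) show ?thesis
  proof cases
    case (to_parent T x p)
    then have "walk k 0 1 d c" using walk_child k by simp
    then show ?thesis unfolding walk_def by (meson le_trans one_le_numeral)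
  next
    case (to_child y T x)
    then have "walk k 0 1 d c" using walk_parent[of k T y x] k by (simp add: children_def)
    then show ?thesis unfolding walk_def by (meson le_trans one_le_numeral)
  next
    case (rotate x T T')
    then obtain r p where rp: "rotation V E T r x p" "T' = rotation.rotated E T x p"
      using rotationE k by (metis fst_conv)
    then interpret rotation V E T r x p by simp
    have T': "k_cut k V E T" "k_cut k V E T'" "rotation_at E p T' T" "T' p = Some x"
      using k rotate rp(2) rotation_at_inverse rotated_simps by auto
    have "walk k (0 + 1 + 0) (1 + 1 + 1) (T', x) (T, x)"
      using walk_child[OF T'(2,4)] walk_rotate[OF T'(2,1,3)] walk_child[OF T'(1) parent_x]
      by (intro walk_trans)
    then show ?thesis using rotate unfolding walk_def numeral_3_eq_3 by simp
  qed
qed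

lemma walk_reverse:
  assumes "walk k i s c d"
  shows "walk k i (3 * s) d c"
proof -
  have "(cut_rotation k ^^ i) U T" if "(cut_rotation k ^^ i) T U" for T U
    using that
  proof (induction i arbitrary: U)
    case (Suc i)
    then obtain W where "(cut_rotation k ^^ i) T W" "cut_rotation k W U" by auto
    then show ?case
      using Suc.IH cut_rotation_sym relpowp_Suc_I2[of "cut_rotation k" U W i T] by blast
  qed simp
  then have "(cut_rotation k ^^ i) (fst d) (fst c)"
    using assms unfolding walk_def by blast
  moreover have "\<exists>t\<le>3 * s'. (cut_step k ^^ t) d c" if "(cut_step k ^^ s') c d" for s'
    using that
  proof (induction s' arbitrary: d)
    case (Suc s')
    then obtain e where "(cut_step k ^^ s') c e" "cut_step k e d" by auto
    then obtain t u where "t \<le> 3 * s'" "(cut_step k ^^ t) e c" "u \<le> 3" "(cut_step k ^^ u) d e"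
      using Suc.IH cut_step_reverse by meson
    then show ?case by (intro exI[of _ "u + t"]) (auto intro: relpowp_trans)
  qed auto
  ultimately show ?thesis
    using assms unfolding walk_def by (meson le_trans mult_le_mono2)
qed

end

section \<open>Reducing the boundaries\<close>

lemma (in search_tree) ancestors_parent:
  assumes "T c = Some p"
  shows "{v. c \<in> subtree_nodes T v} = insert c {v. p \<in> subtree_nodes T v}"
proof (rule set_eqI)
  fix v
  show "v \<in> {v. c \<in> subtree_nodes T v} \<longleftrightarrow> v \<in> insert c {v. p \<in> subtree_nodes T v}"
    using parent_in_subtree[of c T v p] assms subtree_trans[of c T p v] child_in_subtree[of T c p]
    by auto
qed

lemma (in search_tree) ancestors_subset: "x \<in> V \<Longrightarrow> {v. x \<in> subtree_nodes T v} \<subseteq> V"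
proof
  fix v assume x: "x \<in> V" and "v \<in> {v. x \<in> subtree_nodes T v}"
  then have v: "x \<in> subtree_nodes T v" by simp
  show "v \<in> V"
  proof (rule ccontr)
    assume "v \<notin> V"
    then have "children T v = {}" using parent_in_V by (auto simp: children_def)
    then show False using v x \<open>v \<notin> V\<close> subtree_unfold[of T v] by auto
  qed
qed

lemma (in search_tree) root_of: "root_of V T r"
  unfolding root_of_def using root_in_V root_None by blast

lemma (in search_tree) k_cut_iff: "k_cut k V E T \<longleftrightarrow> (\<forall>v\<in>V. width T v \<le> k)"
  unfolding k_cut_def using is_stt by blast

context unrooted_tree
begin

text \<open>
  Depth-first traversal with the pointer at \<open>x\<close>. The nodes in \<open>D\<close> are finished, and neither they
  nor the ancestors of \<open>x\<close> have boundary size \<open>m\<close>. A child outside \<open>D\<close> is entered; if its boundary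
  has size \<open>m\<close>, it is also rotated upwards. Every step decreases \<open>f\<close>, that is, twice the number of
  nodes of boundary size \<open>m\<close>, plus twice the number of unfinished nodes, minus the number of
  ancestors of \<open>x\<close>.
\<close>

lemma sweep:
  assumes "search_tree V E T r" "k_cut m V E T" "2 \<le> m" "m \<le> k" "x \<in> V" "D \<subseteq> V" "x \<notin> D"
    and "\<And>v. v \<in> D \<Longrightarrow> subtree_nodes T v \<subseteq> D" "\<And>v. v \<in> D \<Longrightarrow> width T v < m"
    and "\<And>v. x \<in> subtree_nodes T v \<Longrightarrow> width T v < m"
    and "2 * card {v \<in> V. width T v = m} + 2 * card (V - D) \<le> f + card {v. x \<in> subtree_nodes T v}"
  shows "\<exists>T' i r'. walk k i f (T, x) (T', r') \<and> k_cut (m - 1) V E T' \<and> root_of V T' r' \<and>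
    weight T' + i \<le> weight T"
  using assms
proof (induction f arbitrary: T r x D rule: less_induct)
  case (less f)
  interpret search_tree V E T r by (rule less.prems)
  note kcut = less.prems(2) and mk = less.prems(3,4) and x = less.prems(5) and D = less.prems(6)
    and xD = less.prems(7) and D_closed = less.prems(8) and D_width = less.prems(9)
    and anc_width = less.prems(10) and f = less.prems(11)
  let ?M = "{v \<in> V. width T v = m}" and ?anc = "\<lambda>x. {v. x \<in> subtree_nodes T v}"
  have fin: "finite (V - D)" "finite ?M" "finite (?anc x)"
    using finite_V ancestors_subset[OF x] finite_subset by auto
  \<comment> \<open>\<open>D\<close> is closed under descendants, so no ancestor of \<open>x\<close>
    is finished. Hence \<open>f\<close> is positive and exceeds twice the number of nodes of width
    \<open>m\<close>, which justifies the later values \<open>f - 1\<close> and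
    \<open>f - 2\<close>.\<close>
  have "?anc x \<subseteq> V - D" using ancestors_subset[OF x] D_closed xD by auto
  then have "card (?anc x) \<le> card (V - D)" using fin by (simp add: card_mono)
  moreover have "card (V - D) > 0" using x xD fin by (auto simp: card_gt_0_iff)
  ultimately have f_pos: "0 < f" "2 * card ?M < f" using f by auto
  have k_cut: "k_cut k V E T" using kcut mk k_cut_mono by blast
  show ?case
  proof (cases "children T x \<subseteq> D")
    case True
    have sub: "subtree_nodes T x \<subseteq> insert x D"
      using True D_closed subtree_unfold[of T x] by fastforce
    show ?thesis
    proof (cases "T x")
      case None
      \<comment> \<open>At the root with all children finished, the traversal is over and no width
        \<open>m\<close> remains.\<close>
      then have "V \<subseteq> insert x D" using sub subtree_None[of x T r] x subtree_root by simp
      then have "width T v < m" if "v \<in> V" for v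
        using that D_width[of v] anc_width[of x] by (cases "v = x") auto
      then have "k_cut (m - 1) V E T" unfolding k_cut_iff by fastforce
      moreover have "walk k 0 f (T, x) (T, x)" using walk_refl walk_mono by blast
      moreover have "root_of V T x" using None x by (simp add: root_of_def)
      ultimately show ?thesis by (intro exI[of _ T] exI[of _ 0] exI[of _ x]) simp
    next
      case (Some p)
      have p: "p \<in> V" "p \<noteq> x" using parent_in_V[OF Some] parent_notin_subtree[OF Some] by auto
      have anc: "?anc x = insert x (?anc p)" by (rule ancestors_parent[OF Some])
      have "x \<notin> ?anc p" using parent_notin_subtree[OF Some] by simp
      then have card_anc: "card (?anc x) = Suc (card (?anc p))"
        using anc fin(3) by simp
      have "V - insert x D = V - D - {x}" by blast
      then have card_D: "card (V - D) = Suc (card (V - insert x D))"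
        using x xD fin(1) card.remove[of "V - D" x] by simp
      \<comment> \<open>\<open>x\<close> is finished and left for its parent: one unfinished node
        fewer saves 2, one ancestor fewer costs 1, which pays for the move.\<close>
      have "\<exists>T' i r'. walk k i (f - 1) (T, p) (T', r') \<and> k_cut (m - 1) V E T' \<and> root_of V T' r' \<and>
        weight T' + i \<le> weight T"
      proof (rule less.IH[of "f - 1" T r p "insert x D"])
        show "f - 1 < f" using f_pos by simp
        show "p \<notin> insert x D"
          using p D_closed[of p] xD child_in_subtree[of T x p] Some by auto
        show "insert x D \<subseteq> V" using x D by simp
        show "subtree_nodes T v \<subseteq> insert x D" if "v \<in> insert x D" for v
          using that sub D_closed by blast
        show "width T v < m" if "v \<in> insert x D" for v
          using that anc_width[of x] D_width by auto
        show "width T v < m" if "p \<in> subtree_nodes T v" for v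
          using that anc anc_width[of v] by blast
        show "2 * card ?M + 2 * card (V - insert x D) \<le> f - 1 + card (?anc p)"
          using f card_anc card_D f_pos by simp
      qed (use less.prems p in auto)
      then obtain T' i r' where w: "walk k i (f - 1) (T, p) (T', r')" "k_cut (m - 1) V E T'"
        "root_of V T' r'" "weight T' + i \<le> weight T" by blast
      have "walk k (0 + i) (1 + (f - 1)) (T, x) (T', r')"
        using walk_parent[OF k_cut Some] w(1) by (rule walk_trans)
      then have "walk k i f (T, x) (T', r')" using f_pos by simp
      with w show ?thesis by blast
    qed
  next
    case False
    then obtain c where c: "T c = Some x" "c \<notin> D" by (auto simp: children_def)
    have cV: "c \<in> V" using child_in_V c by blast
    have anc: "?anc c = insert c (?anc x)" by (rule ancestors_parent[OF c(1)])
    have anc_iff: "c \<in> subtree_nodes T v \<longleftrightarrow> v = c \<or> x \<in> subtree_nodes T v" for v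
      using anc by (simp add: set_eq_iff)
    have c_anc: "c \<notin> ?anc x" using parent_notin_subtree[OF c(1)] by simp
    show ?thesis
    proof (cases "width T c = m")
      case False
      then have "width T c < m" using kcut cV unfolding k_cut_iff by fastforce
      have "\<exists>T' i r'. walk k i (f - 1) (T, c) (T', r') \<and> k_cut (m - 1) V E T' \<and> root_of V T' r' \<and>
        weight T' + i \<le> weight T"
      proof (rule less.IH[of "f - 1" T r c D])
        show "f - 1 < f" using f_pos by simp
        show "width T v < m" if "c \<in> subtree_nodes T v" for v
          using that anc_iff[of v] anc_width[of v] \<open>width T c < m\<close> by blast
        show "2 * card ?M + 2 * card (V - D) \<le> f - 1 + card (?anc c)"
          using f anc c_anc fin f_pos by simp
      qed (use less.prems c cV in auto)
      then obtain T' i r' where w: "walk k i (f - 1) (T, c) (T', r')" "k_cut (m - 1) V E T'"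
        "root_of V T' r'" "weight T' + i \<le> weight T" by blast
      have "walk k (0 + i) (1 + (f - 1)) (T, x) (T', r')"
        using walk_child[OF k_cut c(1)] w(1) by (rule walk_trans)
      then have "walk k i f (T, x) (T', r')" using f_pos by simp
      with w show ?thesis by blast
    next
      case True
      interpret rotation V E T r c x
        using c(1) by unfold_locales
      let ?R = rotated
      interpret R: search_tree V E ?R "if x = r then c else r" by (rule search_tree_rotated)
      have xw: "width T x < m" using anc_width[of x] by simp
      have lw: "card (boundary V E lower) < m"
        by (rule width_lower_less) (use kcut k_cut_iff True xw mk in auto)
      have R_less: "width ?R c < m" "width ?R x < m" using width_rotated xw lw by auto
      have R_kcut: "k_cut m V E ?R"
        unfolding R.k_cut_iff
      proof
        fix v assume "v \<in> V"
        then show "width ?R v \<le> m"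
          using R_less width_rotated(3)[of v] kcut unfolding k_cut_iff
          by (cases "v = c \<or> v = x") auto
      qed
      then have R_cut: "k_cut k V E ?R" using mk k_cut_mono by blast
      have other: "v \<noteq> c" "v \<noteq> x" if "v \<in> D" for v using that c xD by auto
      have M: "{v \<in> V. width ?R v = m} = ?M - {c}"
      proof (rule set_eqI)
        fix v
        show "v \<in> {v \<in> V. width ?R v = m} \<longleftrightarrow> v \<in> ?M - {c}"
          using R_less xw width_rotated(3)[of v] by (cases "v = c \<or> v = x") auto
      qed
      have card_M: "card ?M = Suc (card (?M - {c}))"
        using card.remove[of ?M c] fin cV True by simp
      have anc_R: "{v. c \<in> subtree_nodes ?R v} = insert c (?anc x - {x})"
      proof (rule set_eqI)
        fix v
        consider "v = c" | "v = x" | "v \<noteq> c" "v \<noteq> x" by blast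
        then show "v \<in> {v. c \<in> subtree_nodes ?R v} \<longleftrightarrow> v \<in> insert c (?anc x - {x})"
        proof cases
          case 1
          then show ?thesis by simp
        next
          case 2
          then show ?thesis using x_notin_lower x_neq_p by (simp add: subtree_rotated_simps)
        next
          case 3
          then have "c \<in> subtree_nodes T v \<longleftrightarrow> x \<in> subtree_nodes T v"
            using anc_iff by blast
          with 3 show ?thesis by (simp add: subtree_rotated_simps)
        qed
      qed
      \<comment> \<open>\<open>c\<close> replaces \<open>x\<close> among the ancestors, so their
        number is unchanged. The move to \<open>c\<close> and the rotation are paid for by the one
        node of width \<open>m\<close> that disappears. \<open>x\<close> is now an unfinished child
        of \<open>c\<close>.\<close>
      have card_anc: "card {v. c \<in> subtree_nodes ?R v} = card (?anc x)"
        using anc_R c_anc fin(3) card.remove[of "?anc x" x] by simp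
      have "\<exists>T' i r'. walk k i (f - 2) (?R, c) (T', r') \<and> k_cut (m - 1) V E T' \<and> root_of V T' r' \<and>
        weight T' + i \<le> weight ?R"
      proof (rule less.IH)
        show "f - 2 < f" using f_pos by simp
        show "subtree_nodes ?R v \<subseteq> D" if "v \<in> D" for v
          using that other D_closed by (simp add: subtree_rotated_simps)
        show "width ?R v < m" if "v \<in> D" for v
          using that other D_width by (simp add: width_rotated)
        show "width ?R v < m" if v: "c \<in> subtree_nodes ?R v" for v
        proof (cases "v = c")
          case True
          then show ?thesis using R_less by simp
        next
          case False
          then have "v \<noteq> x" "x \<in> subtree_nodes T v" using v anc_R by auto
          then show ?thesis using anc_width False by (simp add: width_rotated)
        qed
        show "2 * card {v \<in> V. width ?R v = m} + 2 * card (V - D) \<le>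
            f - 2 + card {v. c \<in> subtree_nodes ?R v}"
          unfolding M card_anc using f card_M f_pos by simp
      qed (use R.search_tree_axioms R_kcut mk cV D c in auto)
      then obtain T' i r' where w: "walk k i (f - 2) (?R, c) (T', r')" "k_cut (m - 1) V E T'"
        "root_of V T' r'" "weight T' + i \<le> weight ?R" by blast
      have "walk k (0 + 1 + i) (1 + 1 + (f - 2)) (T, x) (T', r')"
        using walk_child[OF k_cut c(1)] walk_rotate[OF k_cut R_cut rotation_at_rotated] w(1)
        by (intro walk_trans)
      moreover have "0 + 1 + i = Suc i" "1 + 1 + (f - 2) = f" using f_pos card_M by simp_all
      ultimately have "walk k (Suc i) f (T, x) (T', r')" by metis
      moreover have "weight T' + Suc i \<le> weight T"
        using w(4) weight_rotated True lw by simp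
      ultimately show ?thesis using w by blast
    qed
  qed
qed

lemma root_of_search_tree:
  assumes "k_cut k V E T" "root_of V T r"
  shows "search_tree V E T r"
proof -
  obtain r' where r': "search_tree V E T r'" using assms(1) k_cut_search_tree by blast
  then interpret search_tree V E T r' .
  have "r = r'"
    using assms(2) subtree_root subtree_None[of r T r'] by (simp add: root_of_def)
  then show ?thesis using r' by simp
qed

text \<open>One sweep from the root, with no node finished, for each boundary size from
  \<open>m\<close> down to 2. At most \<open>card V\<close> nodes have the current size and
  \<open>card V\<close> are unfinished, so a budget of \<open>4 * card V\<close> suffices for each
  sweep.\<close>

lemma reduce_to_one_cut:
  assumes "k_cut m V E T" "root_of V T r" "1 \<le> m" "m \<le> k"
  shows "\<exists>T' i r'. walk k i (4 * card V * m) (T, r) (T', r') \<and> k_cut 1 V E T' \<and> root_of V T' r' \<and>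
    weight T' + i \<le> weight T"
  using assms(3,1,2,4)
proof (induction m arbitrary: T r rule: dec_induct)
  case base
  have "walk k 0 (4 * card V * 1) (T, r) (T, r)" using walk_refl walk_mono by blast
  with base show ?case by (intro exI[of _ T] exI[of _ 0] exI[of _ r]) simp
next
  case (step m)
  interpret search_tree V E T r using root_of_search_tree step.prems by blast
  have anc: "{v. r \<in> subtree_nodes T v} = {r}"
    using subtree_None[of r T] root_None by auto
  have "width T r = 0"
    unfolding subtree_root by (simp add: boundary_def)
  then have "width T v < Suc m" if "r \<in> subtree_nodes T v" for v
    using subtree_None[OF that root_None] by simp
  moreover have "card {v \<in> V. width T v = Suc m} \<le> card V"
    using finite_V by (simp add: card_mono)
  ultimately have "\<exists>T' i r'. walk k i (4 * card V) (T, r) (T', r') \<and> k_cut (Suc m - 1) V E T' \<and>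
      root_of V T' r' \<and> weight T' + i \<le> weight T"
    using anc step.prems step.hyps root_in_V
    by (intro sweep[OF search_tree_axioms step.prems(1), where D = "{}"]) auto
  then obtain T1 i r1 where 1: "walk k i (4 * card V) (T, r) (T1, r1)" "k_cut m V E T1"
    "root_of V T1 r1" "weight T1 + i \<le> weight T" by auto
  obtain T2 j r2 where 2: "walk k j (4 * card V * m) (T1, r1) (T2, r2)" "k_cut 1 V E T2"
    "root_of V T2 r2" "weight T2 + j \<le> weight T1"
    using step.IH[OF 1(2,3)] step.prems by auto
  have "walk k (i + j) (4 * card V + 4 * card V * m) (T, r) (T2, r2)"
    using 1(1) 2(1) by (rule walk_trans)
  then have "walk k (i + j) (4 * card V * Suc m) (T, r) (T2, r2)" by simp
  moreover have "weight T2 + (i + j) \<le> weight T" using 1(4) 2(4) by simp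
  ultimately show ?case using 2(2,3) by blast
qed

end

section \<open>1-cut trees\<close>

context search_tree
begin

text \<open>\<open>v\<close> has a neighbour in the subtree of \<open>u\<close>. If it were below a
  child \<open>d\<close> of \<open>u\<close>, then \<open>u\<close> and \<open>v\<close> would both
  be in the boundary of the subtree of \<open>d\<close>.\<close>

lemma one_cut_parent_edge:
  assumes "k_cut 1 V E T" "T u = Some v"
  shows "E v u"
proof -
  have bd: "v \<in> boundary V E (subtree_nodes T u)" using assms(2) parent_in_boundary by blast
  then obtain a where a: "a \<in> subtree_nodes T u" "E v a" by (auto simp: boundary_def)
  have "a = u"
  proof (rule ccontr)
    assume "a \<noteq> u"
    then obtain d where d: "T d = Some u" "a \<in> subtree_nodes T d"
      using a(1) subtree_unfold[of T u] by (auto simp: children_def)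
    have "v \<notin> subtree_nodes T d"
      using bd subtree_trans[of v T d u] child_in_subtree[of T d u] d(1) by (auto simp: boundary_def)
    then have "v \<in> boundary V E (subtree_nodes T d)"
      using bd d a by (auto simp: boundary_def)
    moreover have "u \<in> boundary V E (subtree_nodes T d)" using parent_in_boundary d by blast
    ultimately have "card {u, v} \<le> width T d"
      using finite_boundary by (intro card_mono) auto
    moreover have "u \<noteq> v" using parent_notin_subtree[OF assms(2)] by auto
    ultimately show False using assms(1) child_in_V[OF d(1)] unfolding k_cut_iff by fastforce
  qed
  with a show ?thesis by simp
qed

text \<open>The upper end of the edge has a child whose subtree contains the lower end. That child
  is itself a neighbour of the upper end, and there is only one in that subtree.\<close>

lemma one_cut_edge_parent:
  assumes "k_cut 1 V E T" "E u v"
  shows "T u = Some v \<or> T v = Some u"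
proof -
  have *: "T u = Some v" if uv: "u \<in> subtree_nodes T v" "E v u" for u v
  proof -
    have "u \<noteq> v" using uv(2) edge_irrefl by auto
    then obtain d where d: "T d = Some v" "u \<in> subtree_nodes T d"
      using uv(1) subtree_unfold[of T v] by (auto simp: children_def)
    have "u = d"
      using unique_neighbour_subtree[OF child_in_V[OF d(1)], of u d v] d uv(2)
        one_cut_parent_edge[OF assms(1) d(1)] parent_notin_subtree[OF d(1)] by simp
    with d show ?thesis by simp
  qed
  show ?thesis
    using edge_comparable[OF assms(2)] * edge_sym assms(2) by blast
qed

end

text \<open>Parents are compared from the root downwards: an edge of \<open>T\<close> must be a
  parent edge of \<open>T'\<close> too, and the reverse orientation is excluded because the parents
  of its upper end already agree.\<close>

lemma (in unrooted_tree) one_cut_unique: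
  assumes "search_tree V E T r" "k_cut 1 V E T" "search_tree V E T' r" "k_cut 1 V E T'"
  shows "T' = T"
proof
  fix v
  interpret search_tree V E T r by (rule assms(1))
  interpret T': search_tree V E T' r by (rule assms(3))
  show "T' v = T v"
  proof (cases "v \<in> V")
    case True
    then have "(\<lambda>u w. T u = Some w)\<^sup>*\<^sup>* v r"
      using subtree_root by (auto simp: subtree_nodes_def)
    then show ?thesis
    proof (induction rule: converse_rtranclp_induct)
      case base
      then show ?case using root_None T'.root_None by simp
    next
      case (step v w)
      have "T' w \<noteq> Some v"
        using step parent_notin_subtree[OF step.hyps(1)] child_in_subtree[of T w v] by auto
      then show ?case
        using T'.one_cut_edge_parent[OF assms(4) one_cut_parent_edge[OF assms(2) step.hyps(1)]]
          step.hyps(1) by simp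
    qed
  next
    case False
    then show ?thesis using dom_T T'.dom_T by (metis domIff subsetD)
  qed
qed

text \<open>The parent \<open>c\<close> of \<open>r\<close> in \<open>T'\<close> is a child of
  \<open>r\<close> in \<open>T\<close>. Rotating at \<open>c\<close> makes it the root, one step
  closer to \<open>r'\<close>, for two pointer steps. The strict bound on \<open>j\<close> later
  yields at most \<open>card V - 1\<close> rotations.\<close>

lemma (in unrooted_tree) move_root:
  assumes "search_tree V E T r" "k_cut 1 V E T" "search_tree V E T' r'" "k_cut 1 V E T'" "1 \<le> k"
  shows "\<exists>j < card {v. r \<in> subtree_nodes T' v}. walk k j (2 * j) (T, r) (T', r')"
  using assms(1,2)
proof (induction "card {v. r \<in> subtree_nodes T' v}" arbitrary: T r rule: less_induct)
  case less
  interpret search_tree V E T r by (rule less.prems)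
  interpret T': search_tree V E T' r' by (rule assms(3))
  have fin: "finite {v. u \<in> subtree_nodes T' v}" if "u \<in> V" for u
    using T'.ancestors_subset[OF that] finite_V finite_subset by blast
  show ?case
  proof (cases "T' r")
    case None
    have "r = r'"
      using subtree_None[of r T' r'] None root_in_V T'.subtree_root by simp
    then have "T' = T" using one_cut_unique less.prems assms(3,4) by blast
    moreover have "0 < card {v. r \<in> subtree_nodes T' v}"
      using fin[OF root_in_V] by (auto simp: card_gt_0_iff intro: exI[of _ r])
    ultimately show ?thesis using \<open>r = r'\<close> walk_refl by (intro exI[of _ 0]) simp
  next
    case (Some c)
    have "E c r" using T'.one_cut_parent_edge[OF assms(4) Some] .
    then have c: "T c = Some r"
      using one_cut_edge_parent[OF less.prems(2), of c r] root_None by auto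
    interpret rotation V E T r c r using c by unfold_locales
    interpret R: search_tree V E rotated c using search_tree_rotated by simp
    \<comment> \<open>The whole node set has no boundary, so after the rotation only
      \<open>c\<close> can bound the subtree of \<open>r\<close>.\<close>
    have bd_r: "boundary V E (subtree_nodes T r) = {}"
      unfolding subtree_root by (simp add: boundary_def)
    then have "card (boundary V E lower) \<le> card {c}"
      using boundary_lower_subset by (intro card_mono) auto
    then have "width rotated v \<le> 1" if "v \<in> V" for v
      using that bd_r width_rotated less.prems(2) unfolding k_cut_iff
      by (cases "v = c \<or> v = r") auto
    then have R_cut: "k_cut 1 V E rotated" unfolding R.k_cut_iff by blast
    have "r \<notin> {v. c \<in> subtree_nodes T' v}" using T'.parent_notin_subtree[OF Some] by simp
    then have card_anc: "card {v. r \<in> subtree_nodes T' v} = Suc (card {v. c \<in> subtree_nodes T' v})"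
      using T'.ancestors_parent[OF Some] fin child_in_V[OF c] by simp
    then obtain j where j: "j < card {v. c \<in> subtree_nodes T' v}"
      "walk k j (2 * j) (rotated, c) (T', r')"
      using less.hyps[OF _ R.search_tree_axioms R_cut] by auto
    have "walk k (0 + 1 + j) (1 + 1 + 2 * j) (T, r) (T', r')"
      using walk_child[of k T c r] walk_rotate[of k T rotated c] rotation_at_rotated c j(2)
        k_cut_mono[OF less.prems(2) assms(5)] k_cut_mono[OF R_cut assms(5)]
      by (intro walk_trans) auto
    then show ?thesis using j(1) card_anc by (intro exI[of _ "Suc j"]) simp
  qed
qed

section \<open>Bounds on the total boundary size\<close>

text \<open>An element of largest \<open>h\<close> is removed. Its set \<open>a v\<close> consists
  of some of the other elements, so its term is at most the last one on the right.\<close>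

lemma sum_min_card_le:
  fixes h :: "'a \<Rightarrow> nat"
  assumes "finite U" "\<And>v. v \<in> U \<Longrightarrow> a v \<subseteq> {w \<in> U. h w < h v}"
  shows "(\<Sum>v\<in>U. min (card (a v)) k) \<le> (\<Sum>i<card U. min i k)"
  using assms
proof (induction "card U" arbitrary: U)
  case (Suc n)
  have fin: "finite (h ` U)" "h ` U \<noteq> {}" using Suc by auto
  from Max_in[OF fin] obtain v where v: "v \<in> U" "h v = Max (h ` U)" by auto
  have max: "h w \<le> h v" if "w \<in> U" for w using v(2) that fin(1) by simp
  have card: "card (U - {v}) = n" using Suc.hyps(2) Suc.prems(1) v(1) by simp
  have "a w \<subseteq> {u \<in> U - {v}. h u < h w}" if "w \<in> U - {v}" for w
    using Suc.prems(2)[of w] max[of w] that by fastforce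
  then have IH: "(\<Sum>v\<in>U - {v}. min (card (a v)) k) \<le> (\<Sum>i<n. min i k)"
    using Suc.hyps(1)[of "U - {v}"] card Suc.prems(1) by simp
  have "a v \<subseteq> U - {v}" using Suc.prems(2)[OF v(1)] by auto
  then have "card (a v) \<le> n" using card card_mono[of "U - {v}" "a v"] Suc.prems(1) by simp
  then have "min (card (a v)) k \<le> min n k" by simp
  then show ?case
    using IH sum.remove[OF Suc.prems(1) v(1), of "\<lambda>v. min (card (a v)) k"] Suc.hyps(2)[symmetric]
    by simp
qed simp

text \<open>Doubling avoids a division by 2, and \<open>min k n\<close> covers both ranges of
  \<open>k\<close> in one formula.\<close>

lemma double_sum_min:
  "2 * int (\<Sum>i<n. min i k) = 2 * int (min k n) * int n - int (min k n) * (int (min k n) + 1)"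
proof (induction n)
  case (Suc n)
  consider "k \<le> n" | "n < k" by linarith
  then show ?case
  proof cases
    case 1
    then show ?thesis using Suc by (simp add: algebra_simps)
  next
    case 2
    then show ?thesis using Suc by (simp add: algebra_simps)
  qed
qed simp

context search_tree
begin

lemma weight_upper:
  assumes "k_cut k V E T"
  shows "weight T \<le> (\<Sum>i<card V. min i k)"
proof -
  have "weight T = (\<Sum>v\<in>V. min (width T v) k)"
    unfolding weight_def using assms k_cut_iff by (intro sum.cong) auto
  also have "\<dots> \<le> (\<Sum>i<card V. min i k)"
  \<comment> \<open>\<open>h\<close> counts the nodes outside the subtree, so it is strictly smaller
    at proper ancestors, where all boundary nodes are.\<close>
  proof (rule sum_min_card_le[where h = "\<lambda>v. card V - card (subtree_nodes T v)"])
    fix v assume v: "v \<in> V"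
    show "boundary V E (subtree_nodes T v) \<subseteq>
      {w \<in> V. card V - card (subtree_nodes T w) < card V - card (subtree_nodes T v)}"
    proof
      fix u assume u: "u \<in> boundary V E (subtree_nodes T v)"
      have uV: "u \<in> V" "u \<notin> subtree_nodes T v" using u by (auto simp: boundary_def)
      have "subtree_nodes T v \<subset> subtree_nodes T u"
        using subtree_trans[of _ T v u] boundary_ancestor(1)[OF u] uV(2) self_in_subtree[of u T] by blast
      then have "card (subtree_nodes T v) < card (subtree_nodes T u)"
        using subtree_finite by (rule psubset_card_mono[rotated])
      moreover have "card (subtree_nodes T u) \<le> card V"
        using subtree_subset[OF uV(1)] finite_V by (rule card_mono[rotated])
      ultimately show "u \<in> {w \<in> V. card V - card (subtree_nodes T w) < card V - card (subtree_nodes T v)}"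
        using uV by simp
    qed
  qed (rule finite_V)
  finally show ?thesis .
qed

text \<open>Every node other than the root has its parent in its boundary.\<close>

lemma weight_lower: "card V \<le> Suc (weight T)"
proof -
  have "1 \<le> width T v" if v: "v \<in> V - {r}" for v
  proof -
    obtain p where "T v = Some p"
      using v subtree_None[of v T r] subtree_root by (cases "T v") auto
    then have "p \<in> boundary V E (subtree_nodes T v)" by (rule parent_in_boundary)
    then have "boundary V E (subtree_nodes T v) \<noteq> {}" by blast
    then show ?thesis using finite_boundary by (simp add: Suc_le_eq card_gt_0_iff)
  qed
  then have "(\<Sum>v\<in>V - {r}. 1) \<le> (\<Sum>v\<in>V - {r}. width T v)" by (rule sum_mono)
  also have "\<dots> \<le> weight T"
    unfolding weight_def using finite_V by (intro sum_mono2) auto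
  finally show ?thesis using finite_V root_in_V by simp
qed

end

section \<open>Composition of the walks and the final count\<close>

lemma (in unrooted_tree) short_walk:
  assumes k: "1 \<le> k" and T: "k_cut k V E T" and T': "k_cut k V E T'"
  shows "\<exists>i r r'. int i \<le> rotation_bound k (card V) \<and> root_of V T r \<and>
    walk k i (18 * k ^ 2 * card V) (T, r) (T', r')"
proof -
  let ?n = "card V" and ?s = "\<Sum>i<card V. min i k"
  obtain r r' where r: "search_tree V E T r" "search_tree V E T' r'"
    using T T' k_cut_search_tree by blast
  obtain U i a where U: "walk k i (4 * ?n * k) (T, r) (U, a)" "k_cut 1 V E U" "root_of V U a"
    "weight U + i \<le> weight T"
    using reduce_to_one_cut[OF T search_tree.root_of[OF r(1)] k le_refl] by blast
  obtain U' i' a' where U': "walk k i' (4 * ?n * k) (T', r') (U', a')" "k_cut 1 V E U'" "root_of V U' a'"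
    "weight U' + i' \<le> weight T'"
    using reduce_to_one_cut[OF T' search_tree.root_of[OF r(2)] k le_refl] by blast
  have st: "search_tree V E U a" "search_tree V E U' a'"
    using U U' root_of_search_tree by blast+
  then obtain j where j: "j < card {v. a \<in> subtree_nodes U' v}" "walk k j (2 * j) (U, a) (U', a')"
    using move_root U(2) U'(2) k by blast
  have "card {v. a \<in> subtree_nodes U' v} \<le> ?n"
    using search_tree.ancestors_subset[OF st(2), of a] finite_V search_tree.root_in_V[OF st(1)]
    by (intro card_mono) auto
  with j have jn: "j < ?n" by simp
  \<comment> \<open>Both trees are reduced to rootings \<open>U\<close> and \<open>U'\<close>, which
    \<open>move_root\<close> connects. The last leg is the reduction of \<open>T'\<close> run
    backwards, whence the factor 3.\<close>
  have "walk k (i + j + i') (4 * ?n * k + 2 * j + 3 * (4 * ?n * k)) (T, r) (T', r')"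
    using U(1) j(2) walk_reverse[OF U'(1)] by (intro walk_trans)
  moreover have "4 * ?n * k + 2 * j + 3 * (4 * ?n * k) \<le> 18 * k ^ 2 * ?n"
  proof -
    have "?n \<le> ?n * k" "?n * k \<le> ?n * k ^ 2" using k by (auto simp: power2_eq_square)
    then have "16 * (?n * k) + 2 * j \<le> 18 * (?n * k ^ 2)" using jn by linarith
    then show ?thesis by (simp add: ac_simps)
  qed
  ultimately have "walk k (i + j + i') (18 * k ^ 2 * ?n) (T, r) (T', r')"
    by (rule walk_mono)
  moreover have "int (i + j + i') \<le> rotation_bound k ?n"
  proof -
    have "weight T \<le> ?s" "weight T' \<le> ?s"
      using search_tree.weight_upper[OF r(1) T] search_tree.weight_upper[OF r(2) T'] by simp_all
    moreover have "?n \<le> Suc (weight U)" "?n \<le> Suc (weight U')"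
      using search_tree.weight_lower[OF st(1)] search_tree.weight_lower[OF st(2)] by simp_all
    \<comment> \<open>Each reduction uses at most \<open>?s - (?n - 1)\<close> rotations and the
      change of root at most \<open>?n - 1\<close>, in total \<open>2 * ?s - ?n + 1\<close>.\<close>
    ultimately have "i + j + i' + ?n \<le> 2 * ?s + 1"
      using U(4) U'(4) jn by linarith
    then have "int (i + j + i') \<le> 2 * int ?s - int ?n + 1" by linarith
    then show ?thesis
      unfolding double_sum_min rotation_bound_def Let_def by (simp add: algebra_simps)
  qed
  ultimately show ?thesis using search_tree.root_of[OF r(1)] by blast
qed

theorem theorem2:
  "\<exists>C :: nat. \<forall>(k :: nat) (V :: 'a set) E T T'.
     1 \<le> k \<longrightarrow> is_tree V E \<longrightarrow> k_cut k V E T \<longrightarrow> k_cut k V E T' \<longrightarrow>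
       (\<exists>(m :: nat) Ts.
          int m \<le> rotation_bound k (card V) \<and>
          Ts 0 = T \<and> Ts m = T' \<and>
          (\<forall>i<m. \<exists>x\<in>V. rotation_at E x (Ts i) (Ts (Suc i))) \<and>
          (\<forall>i\<le>m. k_cut k V E (Ts i))) \<and>
       (\<exists>(m :: nat) Ts ptr.
          m \<le> C * k ^ 2 * card V \<and>
          Ts 0 = T \<and> root_of V T (ptr 0) \<and> Ts m = T' \<and>
          (\<forall>i<m. pointer_step E (Ts i, ptr i) (Ts (Suc i), ptr (Suc i))) \<and>
          (\<forall>i\<le>m. k_cut k V E (Ts i)))"
proof (intro exI[of _ 18] allI impI)
  fix k :: nat and V :: "'a set" and E T T'
  assume k: "1 \<le> k" and "is_tree V E" and T: "k_cut k V E T" and T': "k_cut k V E T'"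
  then interpret unrooted_tree V E by unfold_locales
  obtain m r r' where m: "int m \<le> rotation_bound k (card V)" and r: "root_of V T r"
    and w: "walk k m (18 * k ^ 2 * card V) (T, r) (T', r')"
    using short_walk[OF k T T'] by blast
  obtain Ts where Ts: "Ts 0 = T" "Ts m = T'" "\<And>i. i < m \<Longrightarrow> cut_rotation k (Ts i) (Ts (Suc i))"
    using w unfolding walk_def relpowp_fun_conv by auto
  \<comment> \<open>The last tree starts no further rotation, so for \<open>i = m\<close>, in
    particular for an empty sequence, the claim comes from the assumption on
    \<open>T'\<close>.\<close>
  have "k_cut k V E (Ts i)" if "i \<le> m" for i
    using that Ts T' by (cases "i = m") (auto simp: cut_rotation_def)
  moreover obtain s c where s: "s \<le> 18 * k ^ 2 * card V" and
    c: "c 0 = (T, r)" "c s = (T', r')" "\<And>i. i < s \<Longrightarrow> cut_step k (c i) (c (Suc i))"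
    using w unfolding walk_def relpowp_fun_conv by auto
  moreover have "k_cut k V E (fst (c i))" if "i \<le> s" for i
    using that c T' by (cases "i = s") (auto simp: cut_step_def)
  ultimately show "(\<exists>(m :: nat) Ts.
          int m \<le> rotation_bound k (card V) \<and>
          Ts 0 = T \<and> Ts m = T' \<and>
          (\<forall>i<m. \<exists>x\<in>V. rotation_at E x (Ts i) (Ts (Suc i))) \<and>
          (\<forall>i\<le>m. k_cut k V E (Ts i))) \<and>
       (\<exists>(m :: nat) Ts ptr.
          m \<le> 18 * k ^ 2 * card V \<and>
          Ts 0 = T \<and> root_of V T (ptr 0) \<and> Ts m = T' \<and>
          (\<forall>i<m. pointer_step E (Ts i, ptr i) (Ts (Suc i), ptr (Suc i))) \<and>
          (\<forall>i\<le>m. k_cut k V E (Ts i)))"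
    using m r Ts
    by (intro conjI exI[of _ m] exI[of _ Ts] exI[of _ s] exI[of _ "fst \<circ> c"] exI[of _ "snd \<circ> c"])
      (auto simp: cut_rotation_def cut_step_def)
qed

end
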